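(* Let $X$ be an almost square (ASQ) Banach space and let $N\in\mathbb N$. Then the symmetric projective $N$-tensor product $Y:=\widehat{\otimes}_{\pi,s,N}X$ has the strong diameter two property.
   Context: All Banach spaces are real and nonzero; $\mathbb N=\{1,2,\ldots\}$; $B_X$ and $S_X$ denote the closed unit ball and unit sphere of $X$, and $X^*$ its topological dual. A Banach space $X$ is almost square (ASQ) if for every finite collection $x_1,\ldots,x_k\in S_X$ there exists a sequence $\{y_m\}_m$ in $S_X$ such that $\|y_m\|\to 1$ and $\|x_i\pm y_m\|\to 1$ as $m\to\infty$ (for both choices of sign) for every $i\in\{1,\ldots,k\}$. For a Banach space $X$ and $N\in\mathbb N$, the symmetric projective $N$-tensor product $\widehat{\otimes}_{\pi,s,N}X$ is the completion of the linear span of $\{x^N:=x\otimes\cdots\otimes x\ (N\text{ factors}) : x\in X\}$ in the $N$-fold algebraic tensor power of $X$, under the norm $$\|z\|:=\inf\Big\{\sum_{i=1}^k|\lambda_i| : z=\sum_{i=1}^k\lambda_i x_i^N,\ \lambda_i\in\mathbb R,\ x_i\in S_X\Big\}.$$ A slice of $B_Y$ is a set $S(B_Y,f,\alpha)=\{y\in B_Y: f(y)>1-\alpha\}$ with $f\in S_{Y^*}$ and $\alpha>0$. A convex combination of slices of $B_Y$ is a set $\sum_{i=1}^k\lambda_iS_i$ with $k\in\mathbb N$, $S_i$ slices of $B_Y$, $\lambda_i\in[0,1]$, $\sum_{i=1}^k\lambda_i=1$. A Banach space $Y$ has the strong diameter two property if every convex combination of slices of $B_Y$ has diameter two. *)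

theory Defs
  imports "HOL-Analysis.Analysis" "HOL-Analysis.Finite_Function_Topology"
begin

section \<open>Almost square Banach spaces and the strong diameter two property\<close>

definition almost_square :: "'a::real_normed_vector itself \<Rightarrow> bool" where
  "almost_square _ \<longleftrightarrow>
     (\<forall>A :: 'a set. finite A \<and> A \<subseteq> sphere 0 1 \<longrightarrow>
        (\<exists>y :: nat \<Rightarrow> 'a. (\<forall>m. y m \<in> sphere 0 1) \<and> (\<lambda>m. norm (y m)) \<longlonglongrightarrow> 1 \<and>
           (\<forall>x\<in>A. (\<lambda>m. norm (x + y m)) \<longlonglongrightarrow> 1 \<and> (\<lambda>m. norm (x - y m)) \<longlonglongrightarrow> 1)))"

definition slice :: "('b::real_normed_vector \<Rightarrow>\<^sub>L real) \<Rightarrow> real \<Rightarrow> 'b set" where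
  "slice f \<alpha> = {y \<in> cball 0 1. blinfun_apply f y > 1 - \<alpha>}"

definition unit_ball_slices :: "'b::real_normed_vector set set" where
  "unit_ball_slices = {slice f \<alpha> | f \<alpha>. f \<in> sphere 0 1 \<and> \<alpha> > 0}"

definition convex_combinations_of_slices :: "'b::real_normed_vector set set" where
  "convex_combinations_of_slices =
     {{\<Sum>i<k. l i *\<^sub>R y i | y. \<forall>i<k. y i \<in> S i} | (k::nat) (l::nat \<Rightarrow> real) (S::nat \<Rightarrow> 'b set).
        k \<ge> 1 \<and> (\<forall>i<k. S i \<in> unit_ball_slices) \<and> (\<forall>i<k. l i \<in> {0..1}) \<and> (\<Sum>i<k. l i) = 1}"

definition strong_diameter_two_property :: "'b::banach itself \<Rightarrow> bool" where
  "strong_diameter_two_property _ \<longleftrightarrow>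
     (\<forall>C \<in> (convex_combinations_of_slices :: 'b set set). diameter C = 2)"


section \<open>The algebraic tensor power\<close>

text \<open>
  The algebraic tensor power of \<open>'a\<close> has its factors indexed by the finite type \<open>'n\<close>, so that
  the number of factors is \<open>CARD('n)\<close>.  It is the free real vector space on \<open>'n \<Rightarrow> 'a\<close>
  modulo the subspace spanned by the multilinearity relations.
\<close>

definition multilinearity_relations :: "(('n \<Rightarrow> 'a::real_vector) \<Rightarrow>\<^sub>0 real) set" where
  "multilinearity_relations =
     {Poly_Mapping.single (f(i := x + y)) 1 - Poly_Mapping.single (f(i := x)) 1
        - Poly_Mapping.single (f(i := y)) 1 | f i x y. True} \<union>
     {Poly_Mapping.single (f(i := c *\<^sub>R x)) 1 - c *\<^sub>R Poly_Mapping.single (f(i := x)) 1 | f i c x. True}"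

definition tensor_rel ::
    "(('n \<Rightarrow> 'a::real_vector) \<Rightarrow>\<^sub>0 real) \<Rightarrow> (('n \<Rightarrow> 'a) \<Rightarrow>\<^sub>0 real) \<Rightarrow> bool" where
  "tensor_rel p q \<longleftrightarrow> p - q \<in> span multilinearity_relations"

lemma equivp_tensor_rel:
  "equivp (tensor_rel :: (('n \<Rightarrow> 'a::real_vector) \<Rightarrow>\<^sub>0 real) \<Rightarrow> _)"
proof (rule equivpI)
  show "reflp (tensor_rel :: (('n \<Rightarrow> 'a) \<Rightarrow>\<^sub>0 real) \<Rightarrow> _)"
    by (auto simp: reflp_def tensor_rel_def span_zero)
  show "symp (tensor_rel :: (('n \<Rightarrow> 'a) \<Rightarrow>\<^sub>0 real) \<Rightarrow> _)"
    unfolding symp_def tensor_rel_def by (auto dest: span_neg)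
  show "transp (tensor_rel :: (('n \<Rightarrow> 'a) \<Rightarrow>\<^sub>0 real) \<Rightarrow> _)"
    unfolding transp_def tensor_rel_def
  proof (intro allI impI)
    fix p q r :: "('n \<Rightarrow> 'a) \<Rightarrow>\<^sub>0 real"
    assume "p - q \<in> span multilinearity_relations" "q - r \<in> span multilinearity_relations"
    from span_add[OF this] show "p - r \<in> span multilinearity_relations" by simp
  qed
qed

quotient_type (overloaded) ('a, 'n) tensor_power = "('n \<Rightarrow> 'a::real_vector) \<Rightarrow>\<^sub>0 real" / tensor_rel
  by (rule equivp_tensor_rel)

instantiation tensor_power :: (real_vector, type) real_vector
begin

lift_definition zero_tensor_power :: "('a, 'b) tensor_power" is 0 .

lift_definition plus_tensor_power ::
    "('a, 'b) tensor_power \<Rightarrow> ('a, 'b) tensor_power \<Rightarrow> ('a, 'b) tensor_power" is "(+)"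
  unfolding tensor_rel_def by (drule (1) span_add) (simp add: algebra_simps)

lift_definition minus_tensor_power ::
    "('a, 'b) tensor_power \<Rightarrow> ('a, 'b) tensor_power \<Rightarrow> ('a, 'b) tensor_power" is "(-)"
  unfolding tensor_rel_def by (drule (1) span_diff) (simp add: algebra_simps)

lift_definition uminus_tensor_power :: "('a, 'b) tensor_power \<Rightarrow> ('a, 'b) tensor_power" is uminus
  unfolding tensor_rel_def by (drule span_neg) simp

lift_definition scaleR_tensor_power :: "real \<Rightarrow> ('a, 'b) tensor_power \<Rightarrow> ('a, 'b) tensor_power"
  is scaleR
  unfolding tensor_rel_def by (drule span_scale) (simp add: scaleR_diff_right)

instance
  by standard
    (transfer; simp add: tensor_rel_def span_zero scaleR_add_left scaleR_add_right add_ac)+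

end

lift_definition tensor :: "('n \<Rightarrow> 'a::real_vector) \<Rightarrow> ('a, 'n) tensor_power"
  is "\<lambda>f. Poly_Mapping.single f 1" .

lemma tensor_add: "tensor (f(i := x + y)) = tensor (f(i := x)) + tensor (f(i := y))"
proof (transfer)
  fix f :: "'n \<Rightarrow> 'a" and i x y
  have "Poly_Mapping.single (f(i := x + y)) (1::real) - Poly_Mapping.single (f(i := x)) 1
        - Poly_Mapping.single (f(i := y)) 1 \<in> multilinearity_relations"
    unfolding multilinearity_relations_def by blast
  then show "tensor_rel (Poly_Mapping.single (f(i := x + y)) 1)
      (Poly_Mapping.single (f(i := x)) 1 + Poly_Mapping.single (f(i := y)) 1)"
    unfolding tensor_rel_def by (simp add: diff_diff_eq span_base)
qed

lemma tensor_scaleR: "tensor (f(i := c *\<^sub>R x)) = c *\<^sub>R tensor (f(i := x))"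
proof (transfer)
  fix f :: "'n \<Rightarrow> 'a" and i c x
  have "Poly_Mapping.single (f(i := c *\<^sub>R x)) (1::real) - c *\<^sub>R Poly_Mapping.single (f(i := x)) 1
        \<in> multilinearity_relations"
    unfolding multilinearity_relations_def by blast
  then show "tensor_rel (Poly_Mapping.single (f(i := c *\<^sub>R x)) 1)
      (c *\<^sub>R Poly_Mapping.single (f(i := x)) 1)"
    unfolding tensor_rel_def by (simp add: span_base)
qed

lemma tensor_scaleR_all:
  "tensor (\<lambda>_::'n::finite. c *\<^sub>R x) = c ^ CARD('n) *\<^sub>R tensor (\<lambda>_. x)"
proof -
  have "tensor (\<lambda>i. if i \<in> A then c *\<^sub>R x else x) = c ^ card A *\<^sub>R tensor (\<lambda>_. x)" for A :: "'n set"
  proof (induction A rule: finite_induct[OF finite])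
    case 1
    then show ?case by simp
  next
    case (2 a A)
    let ?f = "\<lambda>i. if i \<in> A then c *\<^sub>R x else x"
    have "(\<lambda>i. if i \<in> insert a A then c *\<^sub>R x else x) = ?f(a := c *\<^sub>R x)"
      by auto
    moreover have "?f(a := x) = ?f"
      using 2 by auto
    ultimately show ?case
      using 2 tensor_scaleR[of ?f a c x] by simp
  qed
  from this[of UNIV] show ?thesis by simp
qed


section \<open>Symmetric tensors and the symmetric projective norm\<close>

typedef (overloaded) ('a, 'n) sym_tensor =
  "span (range (\<lambda>x. tensor (\<lambda>_. x))) :: ('a::real_vector, 'n) tensor_power set"
  by (blast intro: span_zero)

setup_lifting type_definition_sym_tensor

instantiation sym_tensor :: (real_vector, type) real_vector
begin

lift_definition zero_sym_tensor :: "('a, 'b) sym_tensor" is 0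
  by (rule span_zero)

lift_definition plus_sym_tensor ::
    "('a, 'b) sym_tensor \<Rightarrow> ('a, 'b) sym_tensor \<Rightarrow> ('a, 'b) sym_tensor" is "(+)"
  by (rule span_add)

lift_definition minus_sym_tensor ::
    "('a, 'b) sym_tensor \<Rightarrow> ('a, 'b) sym_tensor \<Rightarrow> ('a, 'b) sym_tensor" is "(-)"
  by (rule span_diff)

lift_definition uminus_sym_tensor :: "('a, 'b) sym_tensor \<Rightarrow> ('a, 'b) sym_tensor" is uminus
  by (rule span_neg)

lift_definition scaleR_sym_tensor :: "real \<Rightarrow> ('a, 'b) sym_tensor \<Rightarrow> ('a, 'b) sym_tensor" is scaleR
  by (rule span_scale)

instance
  by standard (transfer; simp add: scaleR_add_left scaleR_add_right)+

end

lift_definition sym_power :: "'a::real_vector \<Rightarrow> ('a, 'n) sym_tensor"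
  is "\<lambda>x. tensor (\<lambda>_. x)"
  by (blast intro: span_base)

definition sym_representation_sums ::
    "('a::real_normed_vector, 'n) sym_tensor \<Rightarrow> real set" where
  "sym_representation_sums z =
     {\<Sum>i<k. \<bar>l i\<bar> | (k::nat) (l::nat \<Rightarrow> real) (x::nat \<Rightarrow> 'a).
        (\<forall>i<k. x i \<in> sphere 0 1) \<and> z = (\<Sum>i<k. l i *\<^sub>R sym_power (x i))}"

definition sym_norm :: "('a::real_normed_vector, 'n) sym_tensor \<Rightarrow> real" where
  "sym_norm z = Inf (sym_representation_sums z)"

lemma sym_power_scaleR:
  "(sym_power (c *\<^sub>R x) :: ('a::real_vector, 'n::finite) sym_tensor) = c ^ CARD('n) *\<^sub>R sym_power x"
  by transfer (rule tensor_scaleR_all)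

lemma sym_representation_sums_nonneg: "s \<in> sym_representation_sums z \<Longrightarrow> 0 \<le> s"
  unfolding sym_representation_sums_def by (auto intro: sum_nonneg)

lemma bdd_below_sym_representation_sums: "bdd_below (sym_representation_sums z)"
  using sym_representation_sums_nonneg by (intro bdd_belowI) blast

lemma sym_representation_sums_zero: "0 \<in> sym_representation_sums 0"
  unfolding sym_representation_sums_def by (auto intro: exI[of _ "0::nat"])

lemma sym_representation_sums_add:
  assumes "s \<in> sym_representation_sums z" "t \<in> sym_representation_sums w"
  shows "s + t \<in> sym_representation_sums (z + w)"
proof -
  from assms obtain k l x k' l' x' where
    1: "\<forall>i<(k::nat). x i \<in> sphere (0::'a) 1" "z = (\<Sum>i<k. l i *\<^sub>R sym_power (x i))"
       "s = (\<Sum>i<k. \<bar>l i\<bar>)" and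
    2: "\<forall>i<(k'::nat). x' i \<in> sphere (0::'a) 1" "w = (\<Sum>i<k'. l' i *\<^sub>R sym_power (x' i))"
       "t = (\<Sum>i<k'. \<bar>l' i\<bar>)"
    unfolding sym_representation_sums_def by blast
  define L where "L i = (if i < k then l i else l' (i - k))" for i
  define X where "X i = (if i < k then x i else x' (i - k))" for i
  have split: "(\<Sum>i<k + k'. g i) = (\<Sum>i<k. g i) + (\<Sum>i<k'. g (k + i))" for g :: "nat \<Rightarrow> 'c::comm_monoid_add"
    by (induction k') (auto simp: add.assoc)
  have "\<forall>i<k + k'. X i \<in> sphere 0 1"
    using 1(1) 2(1) by (auto simp: X_def)
  moreover have "z + w = (\<Sum>i<k + k'. L i *\<^sub>R sym_power (X i))"
    unfolding split 1(2) 2(2) by (simp add: L_def X_def)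
  moreover have "s + t = (\<Sum>i<k + k'. \<bar>L i\<bar>)"
    unfolding split 1(3) 2(3) by (simp add: L_def)
  ultimately show ?thesis
    unfolding sym_representation_sums_def by blast
qed

lemma sym_representation_sums_scaleR:
  assumes "s \<in> sym_representation_sums z"
  shows "\<bar>c\<bar> * s \<in> sym_representation_sums (c *\<^sub>R z)"
proof -
  from assms obtain k l x where
    1: "\<forall>i<(k::nat). x i \<in> sphere (0::'a) 1" "z = (\<Sum>i<k. l i *\<^sub>R sym_power (x i))"
       "s = (\<Sum>i<k. \<bar>l i\<bar>)"
    unfolding sym_representation_sums_def by blast
  have "c *\<^sub>R z = (\<Sum>i<k. (c * l i) *\<^sub>R sym_power (x i))" "\<bar>c\<bar> * s = (\<Sum>i<k. \<bar>c * l i\<bar>)"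
    by (simp_all add: 1 scaleR_sum_right sum_distrib_left abs_mult)
  with 1(1) show ?thesis
    unfolding sym_representation_sums_def mem_Collect_eq
    by (intro exI[of _ k] exI[of _ "\<lambda>i. c * l i"] exI[of _ x]) auto
qed

lemma sym_representation_sums_sym_power:
  "norm x ^ CARD('n) \<in> sym_representation_sums (sym_power x :: ('a::real_normed_vector, 'n::finite) sym_tensor)"
proof (cases "x = 0")
  case True
  have "sym_power (0::'a) = (0 :: ('a, 'n) sym_tensor)"
    using sym_power_scaleR[where 'n = 'n, of 0 "0::'a"] by (simp add: power_0_left)
  with True show ?thesis
    using sym_representation_sums_zero by (simp add: power_0_left)
next
  case False
  have "(sym_power x :: ('a, 'n) sym_tensor)
      = norm x ^ CARD('n) *\<^sub>R sym_power (inverse (norm x) *\<^sub>R x)"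
    using False by (simp add: sym_power_scaleR power_inverse)
  with False show ?thesis
    unfolding sym_representation_sums_def mem_Collect_eq
    by (intro exI[of _ "1::nat"] exI[of _ "\<lambda>_. norm x ^ CARD('n)"]
          exI[of _ "\<lambda>_. inverse (norm x) *\<^sub>R x"]) auto
qed

lemma sym_representation_sums_nonempty:
  "sym_representation_sums (z :: ('a::real_normed_vector, 'n::finite) sym_tensor) \<noteq> {}"
proof -
  have "\<forall>z' :: ('a, 'n) sym_tensor. Rep_sym_tensor z' = t \<longrightarrow> sym_representation_sums z' \<noteq> {}"
    if "t \<in> span (range (\<lambda>x::'a. tensor (\<lambda>_::'n. x)))" for t
    using that
  proof (induction t rule: span_induct_alt)
    case base
    have "z' = 0" if "Rep_sym_tensor z' = 0" for z' :: "('a, 'n) sym_tensor"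
      using that by (metis Rep_sym_tensor_inject zero_sym_tensor.rep_eq)
    then show ?case
      using sym_representation_sums_zero by blast
  next
    case (step c b t)
    then obtain x where b: "b = Rep_sym_tensor (sym_power x :: ('a, 'n) sym_tensor)"
      by (auto simp: sym_power.rep_eq)
    show ?case
    proof (intro allI impI)
      fix z' :: "('a, 'n) sym_tensor"
      assume z': "Rep_sym_tensor z' = c *\<^sub>R b + t"
      define w where "w = z' - c *\<^sub>R sym_power x"
      have "Rep_sym_tensor w = t"
        by (simp add: w_def minus_sym_tensor.rep_eq scaleR_sym_tensor.rep_eq z' b)
      with step obtain s where "s \<in> sym_representation_sums w"
        by blast
      from sym_representation_sums_add[OF sym_representation_sums_scaleR[OF
            sym_representation_sums_sym_power[of x], of c] this]
      show "sym_representation_sums z' \<noteq> {}"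
        unfolding w_def by auto
    qed
  qed
  then show ?thesis
    using Rep_sym_tensor by blast
qed

lemma sym_norm_nonneg: "0 \<le> sym_norm (z :: ('a::real_normed_vector, 'n::finite) sym_tensor)"
  unfolding sym_norm_def
  by (rule cInf_greatest[OF sym_representation_sums_nonempty sym_representation_sums_nonneg])

lemma sym_norm_le: "s \<in> sym_representation_sums z \<Longrightarrow> sym_norm z \<le> s"
  unfolding sym_norm_def by (rule cInf_lower[OF _ bdd_below_sym_representation_sums])

lemma sym_norm_zero [simp]: "sym_norm (0 :: ('a::real_normed_vector, 'n::finite) sym_tensor) = 0"
  using sym_norm_le[OF sym_representation_sums_zero] sym_norm_nonneg by (rule antisym)

lemma sym_norm_less_obtain:
  fixes z :: "('a::real_normed_vector, 'n::finite) sym_tensor"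
  assumes "e > 0"
  obtains s where "s \<in> sym_representation_sums z" "s < sym_norm z + e"
  using cInf_less_iff[OF sym_representation_sums_nonempty bdd_below_sym_representation_sums,
      of z "sym_norm z + e"] assms
  unfolding sym_norm_def by auto

lemma sym_norm_triangle:
  fixes z w :: "('a::real_normed_vector, 'n::finite) sym_tensor"
  shows "sym_norm (z + w) \<le> sym_norm z + sym_norm w"
proof (rule field_le_epsilon)
  fix e :: real assume "e > 0"
  then have "e / 2 > 0" by simp
  obtain s t where st: "s \<in> sym_representation_sums z" "s < sym_norm z + e / 2"
    "t \<in> sym_representation_sums w" "t < sym_norm w + e / 2"
    using sym_norm_less_obtain[OF \<open>e / 2 > 0\<close>] by metis
  from sym_norm_le[OF sym_representation_sums_add[OF st(1,3)]] st(2,4)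
  show "sym_norm (z + w) \<le> sym_norm z + sym_norm w + e" by simp
qed

lemma sym_norm_scaleR_le:
  fixes z :: "('a::real_normed_vector, 'n::finite) sym_tensor"
  shows "sym_norm (c *\<^sub>R z) \<le> \<bar>c\<bar> * sym_norm z"
proof (cases "c = 0")
  case False
  have "sym_norm (c *\<^sub>R z) / \<bar>c\<bar> \<le> sym_norm z"
    unfolding sym_norm_def[of z]
  proof (rule cInf_greatest[OF sym_representation_sums_nonempty])
    fix s assume "s \<in> sym_representation_sums z"
    from sym_norm_le[OF sym_representation_sums_scaleR[OF this, of c]]
    show "sym_norm (c *\<^sub>R z) / \<bar>c\<bar> \<le> s"
      using False by (simp add: field_simps)
  qed
  then show ?thesis using False by (simp add: field_simps)
qed simp

lemma sym_norm_scaleR: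
  fixes z :: "('a::real_normed_vector, 'n::finite) sym_tensor"
  shows "sym_norm (c *\<^sub>R z) = \<bar>c\<bar> * sym_norm z"
proof (cases "c = 0")
  case False
  have "sym_norm z \<le> \<bar>inverse c\<bar> * sym_norm (c *\<^sub>R z)"
    using sym_norm_scaleR_le[of "inverse c" "c *\<^sub>R z"] False by simp
  then have "\<bar>c\<bar> * sym_norm z \<le> sym_norm (c *\<^sub>R z)"
    using False by (simp add: field_simps)
  with sym_norm_scaleR_le show ?thesis by (rule antisym)
qed simp

lemma sym_norm_minus_commute:
  fixes z w :: "('a::real_normed_vector, 'n::finite) sym_tensor"
  shows "sym_norm (z - w) = sym_norm (w - z)"
  using sym_norm_scaleR[of "-1" "w - z"] by simp

lemma sym_norm_triangle_diff:
  fixes u v w :: "('a::real_normed_vector, 'n::finite) sym_tensor"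
  shows "sym_norm (u - w) \<le> sym_norm (u - v) + sym_norm (v - w)"
  using sym_norm_triangle[of "u - v" "v - w"] by simp

lemma sym_norm_diff_abs:
  fixes z w :: "('a::real_normed_vector, 'n::finite) sym_tensor"
  shows "\<bar>sym_norm z - sym_norm w\<bar> \<le> sym_norm (z - w)"
  using sym_norm_triangle[of "z - w" w] sym_norm_triangle[of "w - z" z]
  by (simp add: sym_norm_minus_commute[of w z])

lemma sym_norm_null:
  fixes p :: "nat \<Rightarrow> ('a::real_normed_vector, 'n::finite) sym_tensor"
  assumes "\<And>n. sym_norm (p n) \<le> g n" "g \<longlonglongrightarrow> 0"
  shows "(\<lambda>n. sym_norm (p n)) \<longlonglongrightarrow> 0"
  by (rule Lim_null_comparison[OF _ assms(2)])
    (simp add: always_eventually assms(1) sym_norm_nonneg)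


section \<open>The symmetric projective tensor product\<close>

text \<open>
  The completion consists of the \<^const>\<open>sym_norm\<close>-Cauchy sequences of symmetric tensors, modulo
  the sequences converging to 0.  Since null sequences are factored out, the construction needs only
  the seminorm properties of \<^const>\<open>sym_norm\<close>.  The canonical map \<open>of_sym_tensor\<close> below is
  linear and isometric with dense range.
\<close>

definition sym_cauchy :: "(nat \<Rightarrow> ('a::real_normed_vector, 'n::finite) sym_tensor) \<Rightarrow> bool" where
  "sym_cauchy p \<longleftrightarrow> (\<forall>e>0. \<exists>M. \<forall>m\<ge>M. \<forall>n\<ge>M. sym_norm (p m - p n) < e)"

definition sym_completion_rel ::
    "(nat \<Rightarrow> ('a::real_normed_vector, 'n::finite) sym_tensor) \<Rightarrow> (nat \<Rightarrow> ('a, 'n) sym_tensor) \<Rightarrow> bool"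
  where "sym_completion_rel p q \<longleftrightarrow>
    sym_cauchy p \<and> sym_cauchy q \<and> (\<lambda>n. sym_norm (p n - q n)) \<longlonglongrightarrow> 0"

lemma sym_cauchy_const: "sym_cauchy (\<lambda>_. z)"
  by (simp add: sym_cauchy_def)

lemma sym_cauchy_add:
  assumes "sym_cauchy p" "sym_cauchy q"
  shows "sym_cauchy (\<lambda>n. p n + q n)"
  unfolding sym_cauchy_def
proof (intro allI impI)
  fix e :: real assume "e > 0"
  then have "e / 2 > 0" by simp
  with assms obtain M M' where M: "\<forall>m\<ge>M. \<forall>n\<ge>M. sym_norm (p m - p n) < e / 2"
    and M': "\<forall>m\<ge>M'. \<forall>n\<ge>M'. sym_norm (q m - q n) < e / 2"
    unfolding sym_cauchy_def by meson
  have "sym_norm (p m + q m - (p n + q n)) < e" if "m \<ge> max M M'" "n \<ge> max M M'" for m n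
  proof -
    have "sym_norm (p m + q m - (p n + q n)) \<le> sym_norm (p m - p n) + sym_norm (q m - q n)"
      using sym_norm_triangle[of "p m - p n" "q m - q n"] by (simp add: algebra_simps)
    moreover have "sym_norm (p m - p n) < e / 2" "sym_norm (q m - q n) < e / 2"
      using M M' that by auto
    ultimately show ?thesis by linarith
  qed
  then show "\<exists>M. \<forall>m\<ge>M. \<forall>n\<ge>M. sym_norm (p m + q m - (p n + q n)) < e" by blast
qed

lemma sym_cauchy_scaleR:
  assumes "sym_cauchy p"
  shows "sym_cauchy (\<lambda>n. c *\<^sub>R p n)"
  unfolding sym_cauchy_def
proof (intro allI impI)
  fix e :: real assume "e > 0"
  then have "e / (\<bar>c\<bar> + 1) > 0" by (simp add: add_pos_nonneg)
  with assms obtain M where M: "\<forall>m\<ge>M. \<forall>n\<ge>M. sym_norm (p m - p n) < e / (\<bar>c\<bar> + 1)"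
    unfolding sym_cauchy_def by meson
  have "sym_norm (c *\<^sub>R p m - c *\<^sub>R p n) < e" if "m \<ge> M" "n \<ge> M" for m n
  proof -
    have "sym_norm (c *\<^sub>R p m - c *\<^sub>R p n) = \<bar>c\<bar> * sym_norm (p m - p n)"
      by (metis scaleR_diff_right sym_norm_scaleR)
    also have "\<dots> \<le> (\<bar>c\<bar> + 1) * sym_norm (p m - p n)"
      by (intro mult_right_mono sym_norm_nonneg) simp
    also have "\<dots> < e"
      using M that by (simp add: field_simps add_pos_nonneg)
    finally show ?thesis .
  qed
  then show "\<exists>M. \<forall>m\<ge>M. \<forall>n\<ge>M. sym_norm (c *\<^sub>R p m - c *\<^sub>R p n) < e" by blast
qed

lemma sym_cauchy_uminus: "sym_cauchy p \<Longrightarrow> sym_cauchy (\<lambda>n. - p n)"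
  using sym_cauchy_scaleR[of p "-1"] by simp

lemma sym_cauchy_diff: "sym_cauchy p \<Longrightarrow> sym_cauchy q \<Longrightarrow> sym_cauchy (\<lambda>n. p n - q n)"
  using sym_cauchy_add[of p "\<lambda>n. - q n"] sym_cauchy_uminus[of q] by simp

lemma sym_cauchy_convergent:
  assumes "sym_cauchy p"
  shows "(\<lambda>n. sym_norm (p n)) \<longlonglongrightarrow> lim (\<lambda>n. sym_norm (p n))"
proof -
  have "Cauchy (\<lambda>n. sym_norm (p n))"
    unfolding Cauchy_def dist_real_def
    using assms sym_norm_diff_abs unfolding sym_cauchy_def by (meson le_less_trans)
  then show ?thesis
    by (simp add: Cauchy_convergent_iff convergent_LIMSEQ_iff)
qed

lemma part_equivp_sym_completion_rel:
  "part_equivp (sym_completion_rel :: (nat \<Rightarrow> ('a::real_normed_vector, 'n::finite) sym_tensor) \<Rightarrow> _)"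
proof (rule part_equivpI)
  show "\<exists>p :: nat \<Rightarrow> ('a, 'n) sym_tensor. sym_completion_rel p p"
    by (auto simp: sym_completion_rel_def intro: sym_cauchy_const)
  show "symp (sym_completion_rel :: (nat \<Rightarrow> ('a, 'n) sym_tensor) \<Rightarrow> _)"
    by (auto simp: symp_def sym_completion_rel_def sym_norm_minus_commute)
  show "transp (sym_completion_rel :: (nat \<Rightarrow> ('a, 'n) sym_tensor) \<Rightarrow> _)"
    unfolding transp_def sym_completion_rel_def
  proof safe
    fix p q r :: "nat \<Rightarrow> ('a, 'n) sym_tensor"
    assume "(\<lambda>n. sym_norm (p n - q n)) \<longlonglongrightarrow> 0" "(\<lambda>n. sym_norm (q n - r n)) \<longlonglongrightarrow> 0"
    from tendsto_add[OF this] have "(\<lambda>n. sym_norm (p n - q n) + sym_norm (q n - r n)) \<longlonglongrightarrow> 0"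
      by simp
    then show "(\<lambda>n. sym_norm (p n - r n)) \<longlonglongrightarrow> 0"
      by (rule sym_norm_null[OF sym_norm_triangle_diff])
  qed
qed

quotient_type (overloaded) ('a, 'n) sym_proj_tensor =
    "nat \<Rightarrow> ('a::real_normed_vector, 'n::finite) sym_tensor" / partial: sym_completion_rel
  by (rule part_equivp_sym_completion_rel)

instantiation sym_proj_tensor :: (real_normed_vector, finite) real_vector
begin

lift_definition zero_sym_proj_tensor :: "('a, 'b) sym_proj_tensor" is "\<lambda>_. 0"
  by (simp add: sym_completion_rel_def sym_cauchy_const)

lift_definition plus_sym_proj_tensor ::
    "('a, 'b) sym_proj_tensor \<Rightarrow> ('a, 'b) sym_proj_tensor \<Rightarrow> ('a, 'b) sym_proj_tensor"
  is "\<lambda>p q n. p n + q n"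
  unfolding sym_completion_rel_def
proof (intro conjI; (elim conjE)?)
  fix p p' q q' :: "nat \<Rightarrow> ('a, 'b) sym_tensor"
  assume "(\<lambda>n. sym_norm (p n - p' n)) \<longlonglongrightarrow> 0" "(\<lambda>n. sym_norm (q n - q' n)) \<longlonglongrightarrow> 0"
  from tendsto_add[OF this] have "(\<lambda>n. sym_norm (p n - p' n) + sym_norm (q n - q' n)) \<longlonglongrightarrow> 0"
    by simp
  moreover have "sym_norm (p n + q n - (p' n + q' n)) \<le> sym_norm (p n - p' n) + sym_norm (q n - q' n)" for n
    using sym_norm_triangle[of "p n - p' n" "q n - q' n"] by (simp add: algebra_simps)
  ultimately show "(\<lambda>n. sym_norm (p n + q n - (p' n + q' n))) \<longlonglongrightarrow> 0"
    by (rule sym_norm_null[rotated])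
qed (rule sym_cauchy_add, assumption+)+

lift_definition scaleR_sym_proj_tensor ::
    "real \<Rightarrow> ('a, 'b) sym_proj_tensor \<Rightarrow> ('a, 'b) sym_proj_tensor" is "\<lambda>c p n. c *\<^sub>R p n"
  unfolding sym_completion_rel_def
proof (intro conjI; (elim conjE)?)
  fix c :: real and p q :: "nat \<Rightarrow> ('a, 'b) sym_tensor"
  assume "(\<lambda>n. sym_norm (p n - q n)) \<longlonglongrightarrow> 0"
  from tendsto_mult_right_zero[OF this, of "\<bar>c\<bar>"]
  show "(\<lambda>n. sym_norm (c *\<^sub>R p n - c *\<^sub>R q n)) \<longlonglongrightarrow> 0"
    by (simp only: sym_norm_scaleR flip: scaleR_diff_right)
qed (rule sym_cauchy_scaleR, assumption)+

lift_definition uminus_sym_proj_tensor :: "('a, 'b) sym_proj_tensor \<Rightarrow> ('a, 'b) sym_proj_tensor"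
  is "\<lambda>p n. - p n"
  unfolding sym_completion_rel_def
proof (intro conjI; (elim conjE)?)
  fix p q :: "nat \<Rightarrow> ('a, 'b) sym_tensor"
  assume "(\<lambda>n. sym_norm (p n - q n)) \<longlonglongrightarrow> 0"
  moreover have "sym_norm (- p n - - q n) = sym_norm (p n - q n)" for n
    using sym_norm_minus_commute[of "q n" "p n"] by simp
  ultimately show "(\<lambda>n. sym_norm (- p n - - q n)) \<longlonglongrightarrow> 0"
    by simp
qed (rule sym_cauchy_uminus, assumption)+

lift_definition minus_sym_proj_tensor ::
    "('a, 'b) sym_proj_tensor \<Rightarrow> ('a, 'b) sym_proj_tensor \<Rightarrow> ('a, 'b) sym_proj_tensor"
  is "\<lambda>p q n. p n - q n"
  unfolding sym_completion_rel_def
proof (intro conjI; (elim conjE)?)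
  fix p p' q q' :: "nat \<Rightarrow> ('a, 'b) sym_tensor"
  assume "(\<lambda>n. sym_norm (p n - p' n)) \<longlonglongrightarrow> 0" "(\<lambda>n. sym_norm (q n - q' n)) \<longlonglongrightarrow> 0"
  from tendsto_add[OF this] have "(\<lambda>n. sym_norm (p n - p' n) + sym_norm (q n - q' n)) \<longlonglongrightarrow> 0"
    by simp
  moreover have "sym_norm (p n - q n - (p' n - q' n)) \<le> sym_norm (p n - p' n) + sym_norm (q n - q' n)" for n
    using sym_norm_triangle[of "p n - p' n" "q' n - q n"]
    by (simp add: algebra_simps sym_norm_minus_commute[of "q' n"])
  ultimately show "(\<lambda>n. sym_norm (p n - q n - (p' n - q' n))) \<longlonglongrightarrow> 0"
    by (rule sym_norm_null[rotated])
qed (rule sym_cauchy_diff, assumption+)+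

instance
  by standard
    (transfer; simp add: sym_completion_rel_def sym_cauchy_add sym_cauchy_scaleR sym_cauchy_const
       sym_cauchy_diff sym_cauchy_uminus scaleR_add_left scaleR_add_right add_ac)+

end

instantiation sym_proj_tensor :: (real_normed_vector, finite) real_normed_vector
begin

lift_definition norm_sym_proj_tensor :: "('a, 'b) sym_proj_tensor \<Rightarrow> real"
  is "\<lambda>p. lim (\<lambda>n. sym_norm (p n))"
proof -
  fix p q :: "nat \<Rightarrow> ('a, 'b) sym_tensor"
  assume *: "sym_completion_rel p q"
  have "(\<lambda>n. sym_norm (p n) - sym_norm (q n)) \<longlonglongrightarrow> 0"
    by (rule Lim_null_comparison[of _ "\<lambda>n. sym_norm (p n - q n)"])
      (use * in \<open>auto simp: sym_completion_rel_def sym_norm_diff_abs\<close>)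
  moreover have "(\<lambda>n. sym_norm (p n) - sym_norm (q n)) \<longlonglongrightarrow>
      lim (\<lambda>n. sym_norm (p n)) - lim (\<lambda>n. sym_norm (q n))"
    using * unfolding sym_completion_rel_def by (intro tendsto_diff sym_cauchy_convergent) auto
  ultimately show "lim (\<lambda>n. sym_norm (p n)) = lim (\<lambda>n. sym_norm (q n))"
    using LIMSEQ_unique by fastforce
qed

definition dist_sym_proj_tensor :: "('a, 'b) sym_proj_tensor \<Rightarrow> ('a, 'b) sym_proj_tensor \<Rightarrow> real"
  where "dist_sym_proj_tensor x y = norm (x - y)"

definition sgn_sym_proj_tensor :: "('a, 'b) sym_proj_tensor \<Rightarrow> ('a, 'b) sym_proj_tensor"
  where "sgn_sym_proj_tensor x = inverse (norm x) *\<^sub>R x"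

definition uniformity_sym_proj_tensor ::
    "(('a, 'b) sym_proj_tensor \<times> ('a, 'b) sym_proj_tensor) filter"
  where "uniformity_sym_proj_tensor = (INF e\<in>{0<..}. principal {(x, y). dist x y < e})"

definition open_sym_proj_tensor :: "('a, 'b) sym_proj_tensor set \<Rightarrow> bool"
  where "open_sym_proj_tensor U =
    (\<forall>x\<in>U. \<forall>\<^sub>F (x', y) in uniformity. x' = x \<longrightarrow> y \<in> U)"

instance
proof
  fix x y :: "('a, 'b) sym_proj_tensor" and c :: real and U :: "('a, 'b) sym_proj_tensor set"
  show "dist x y = norm (x - y)" by (rule dist_sym_proj_tensor_def)
  show "sgn x = x /\<^sub>R norm x" by (rule sgn_sym_proj_tensor_def)
  show "uniformity = (INF e\<in>{0<..}. principal {(x::('a, 'b) sym_proj_tensor, y). dist x y < e})"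
    by (rule uniformity_sym_proj_tensor_def)
  show "open U = (\<forall>x\<in>U. \<forall>\<^sub>F (x', y) in uniformity. x' = x \<longrightarrow> y \<in> U)"
    by (rule open_sym_proj_tensor_def)
  show "norm x = 0 \<longleftrightarrow> x = 0"
  proof transfer
    fix p :: "nat \<Rightarrow> ('a, 'b) sym_tensor"
    assume "sym_completion_rel p p"
    then have "sym_cauchy p" by (simp add: sym_completion_rel_def)
    have lim: "(\<lambda>n. sym_norm (p n)) \<longlonglongrightarrow> lim (\<lambda>n. sym_norm (p n))"
      by (rule sym_cauchy_convergent[OF \<open>sym_cauchy p\<close>])
    have "lim (\<lambda>n. sym_norm (p n)) = 0 \<longleftrightarrow> (\<lambda>n. sym_norm (p n)) \<longlonglongrightarrow> 0"
      using lim limI by metis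
    with \<open>sym_cauchy p\<close> show "lim (\<lambda>n. sym_norm (p n)) = 0 \<longleftrightarrow> sym_completion_rel p (\<lambda>_. 0)"
      by (simp add: sym_completion_rel_def sym_cauchy_const)
  qed
  show "norm (x + y) \<le> norm x + norm y"
  proof transfer
    fix p q :: "nat \<Rightarrow> ('a, 'b) sym_tensor"
    assume "sym_completion_rel p p" "sym_completion_rel q q"
    then have pq: "sym_cauchy p" "sym_cauchy q" by (auto simp: sym_completion_rel_def)
    show "lim (\<lambda>n. sym_norm (p n + q n)) \<le> lim (\<lambda>n. sym_norm (p n)) + lim (\<lambda>n. sym_norm (q n))"
      by (rule LIMSEQ_le[OF sym_cauchy_convergent[OF sym_cauchy_add[OF pq]]
            tendsto_add[OF sym_cauchy_convergent[OF pq(1)] sym_cauchy_convergent[OF pq(2)]]])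
        (simp add: sym_norm_triangle)
  qed
  show "norm (c *\<^sub>R x) = \<bar>c\<bar> * norm x"
  proof transfer
    fix c :: real and p :: "nat \<Rightarrow> ('a, 'b) sym_tensor"
    assume "sym_completion_rel p p"
    then have "sym_cauchy p" by (simp add: sym_completion_rel_def)
    then show "lim (\<lambda>n. sym_norm (c *\<^sub>R p n)) = \<bar>c\<bar> * lim (\<lambda>n. sym_norm (p n))"
      unfolding sym_norm_scaleR by (intro limI tendsto_mult_left sym_cauchy_convergent)
  qed
qed

end

definition of_sym_tensor ::
    "('a::real_normed_vector, 'n::finite) sym_tensor \<Rightarrow> ('a, 'n) sym_proj_tensor"
  where "of_sym_tensor z = abs_sym_proj_tensor (\<lambda>_. z)"

lemma sym_completion_rel_const: "sym_completion_rel (\<lambda>_. z) (\<lambda>_. z)"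
  by (simp add: sym_completion_rel_def sym_cauchy_const)

lemma linear_of_sym_tensor: "linear of_sym_tensor"
  by (rule linearI)
    (simp_all add: of_sym_tensor_def plus_sym_proj_tensor.abs_eq scaleR_sym_proj_tensor.abs_eq
      sym_completion_rel_const)

lemma norm_of_sym_tensor: "norm (of_sym_tensor z) = sym_norm z"
  by (simp add: of_sym_tensor_def norm_sym_proj_tensor.abs_eq sym_completion_rel_const limI)

lemma of_sym_tensor_tendsto:
  assumes "sym_cauchy p"
  shows "(\<lambda>m. of_sym_tensor (p m)) \<longlonglongrightarrow> abs_sym_proj_tensor p"
proof (rule metric_LIMSEQ_I)
  fix e :: real assume "e > 0"
  then have "e / 2 > 0" by simp
  with assms obtain M where M: "\<forall>m\<ge>M. \<forall>n\<ge>M. sym_norm (p m - p n) < e / 2"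
    unfolding sym_cauchy_def by meson
  have "dist (of_sym_tensor (p m)) (abs_sym_proj_tensor p) < e" if "m \<ge> M" for m
  proof -
    have rel: "sym_completion_rel p p" "sym_completion_rel (\<lambda>_. p m) (\<lambda>_. p m)"
      using assms by (auto simp: sym_completion_rel_def sym_cauchy_const)
    have c: "sym_cauchy (\<lambda>n. p m - p n)"
      by (intro sym_cauchy_diff sym_cauchy_const assms)
    have "dist (of_sym_tensor (p m)) (abs_sym_proj_tensor p) = lim (\<lambda>n. sym_norm (p m - p n))"
      using c rel
      by (simp add: dist_norm of_sym_tensor_def minus_sym_proj_tensor.abs_eq
          norm_sym_proj_tensor.abs_eq sym_completion_rel_def)
    also have "\<dots> \<le> e / 2"
      using M that by (intro LIMSEQ_le_const2[OF sym_cauchy_convergent[OF c]]) (auto intro: less_imp_le)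
    finally show ?thesis using \<open>e > 0\<close> by simp
  qed
  then show "\<exists>M. \<forall>m\<ge>M. dist (of_sym_tensor (p m)) (abs_sym_proj_tensor p) < e" by blast
qed

lemma closure_range_of_sym_tensor: "closure (range of_sym_tensor) = UNIV"
proof -
  have "y \<in> closure (range of_sym_tensor)" for y :: "('a, 'b) sym_proj_tensor"
  proof (induction y)
    case (1 p)
    then have "sym_cauchy p" by (simp add: sym_completion_rel_def)
    from of_sym_tensor_tendsto[OF this] show ?case
      unfolding closure_sequential by (intro exI[of _ "\<lambda>m. of_sym_tensor (p m)"]) simp
  qed
  then show ?thesis by blast
qed

instance sym_proj_tensor :: (real_normed_vector, finite) banach
proof
  fix Y :: "nat \<Rightarrow> ('a, 'b) sym_proj_tensor"
  assume Y: "Cauchy Y"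
  have "\<exists>z. dist (of_sym_tensor z) (Y k) < 1 / real (Suc k)" for k
    using closure_approachable[of "Y k" "range of_sym_tensor"] closure_range_of_sym_tensor by auto
  then obtain z where z: "\<And>k. dist (of_sym_tensor (z k)) (Y k) < 1 / real (Suc k)"
    by metis
  have null: "(\<lambda>k. of_sym_tensor (z k) - Y k) \<longlonglongrightarrow> 0"
    by (rule Lim_null_comparison[OF _ LIMSEQ_Suc[OF lim_1_over_n]])
      (use z in \<open>auto simp: dist_norm intro!: always_eventually less_imp_le\<close>)
  have "Cauchy (\<lambda>k. of_sym_tensor (z k))"
  proof (rule metric_CauchyI)
    fix e :: real assume "e > 0"
    then have "e / 3 > 0" by simp
    from metric_LIMSEQ_D[OF null this] obtain M
      where M: "\<And>k. k \<ge> M \<Longrightarrow> dist (of_sym_tensor (z k)) (Y k) < e / 3"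
      by (auto simp: dist_norm)
    from metric_CauchyD[OF Y \<open>e / 3 > 0\<close>] obtain M'
      where M': "\<And>m n. m \<ge> M' \<Longrightarrow> n \<ge> M' \<Longrightarrow> dist (Y m) (Y n) < e / 3"
      by blast
    have "dist (of_sym_tensor (z m)) (of_sym_tensor (z n)) < e" if "m \<ge> max M M'" "n \<ge> max M M'" for m n
    proof -
      have "dist (of_sym_tensor (z m)) (Y m) < e / 3" "dist (of_sym_tensor (z n)) (Y n) < e / 3"
        "dist (Y m) (Y n) < e / 3"
        using M M' that by auto
      moreover have "dist (of_sym_tensor (z m)) (of_sym_tensor (z n))
          \<le> dist (of_sym_tensor (z m)) (Y m) + dist (Y m) (Y n) + dist (of_sym_tensor (z n)) (Y n)"
        using dist_triangle[of "of_sym_tensor (z m)" "of_sym_tensor (z n)" "Y m"]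
          dist_triangle[of "Y m" "of_sym_tensor (z n)" "Y n"]
        by (simp add: dist_commute)
      ultimately show ?thesis by linarith
    qed
    then show "\<exists>M. \<forall>m\<ge>M. \<forall>n\<ge>M. dist (of_sym_tensor (z m)) (of_sym_tensor (z n)) < e"
      by blast
  qed
  moreover have "dist (of_sym_tensor (z m)) (of_sym_tensor (z n)) = sym_norm (z m - z n)" for m n
    by (simp add: dist_norm norm_of_sym_tensor linear_diff[OF linear_of_sym_tensor, symmetric])
  ultimately have "sym_cauchy z"
    unfolding Cauchy_def sym_cauchy_def by (simp only:)
  from tendsto_diff[OF of_sym_tensor_tendsto[OF this] null] have "Y \<longlonglongrightarrow> abs_sym_proj_tensor z"
    by simp
  then show "convergent Y"
    by (rule convergentI)
qed

end

theory Submission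
  imports Defs "HOL-Computational_Algebra.Polynomial"
begin

text \<open>
  Every slice of the unit ball contains a vector \<open>\<sigma> x\<^sup>N\<close> with \<open>\<sigma> = \<plusminus>1\<close> and \<open>x\<close> in the open unit ball
  (\<open>unit_functional_near_power\<close>). A convex combination of slices thus contains
  \<open>\<Sum>i. l i \<sigma> i (x i)\<^sup>N\<close>, and the task is to move the points \<open>x i\<close>, without leaving the slices, to points
  \<open>u i\<close> and \<open>v i\<close> of the open unit ball such that a single functional of norm at most 1 is nearly
  \<open>\<sigma> i\<close> at all the powers of the \<open>u i\<close> and nearly \<open>- \<sigma> i\<close> at all those of the \<open>v i\<close>. The two sums
  obtained in this way are then at distance nearly 2.

  To stay in the slices, consider the \<open>N\<close>-homogeneous polynomial \<open>q(x) = \<sigma> f(x\<^sup>N)\<close>, which is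
  bounded by 1 on the unit ball. Almost squareness, used repeatedly, gives arbitrarily long lists
  \<open>ys\<close> that behave like the unit vectors of \<open>c\<^sub>0\<close>: the point \<open>x\<close> plus the sum of any subset of \<open>ys\<close>
  remains in the ball. The mean of \<open>q\<close> over random subset sums, where each vector is taken with
  probability \<open>p\<close>, is a polynomial in \<open>p\<close> of degree at most \<open>N\<close> that is bounded by 1 on the unit
  interval. Its derivative at 0, the sum of all \<open>q(x + y) - q(x)\<close>, is therefore bounded by a
  constant depending on \<open>N\<close> only. Since this applies to every sublist, \<open>q\<close> can drop by a fixed amount
  along a bounded number of vectors of the list only, and the others are good
  (\<open>few_decreasing_increments\<close>, \<open>almost_square_direction\<close>). In effect, polynomials are weakly
  sequentially continuous along \<open>c\<^sub>0\<close>-like sequences, in a finite form.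

  To separate the powers, two successive good directions \<open>y\<close> and \<open>y'\<close> are added:
  \<open>x i + y + \<sigma> i y'\<close> and \<open>x i + y - \<sigma> i y'\<close>. Functionals \<open>a\<close> and \<open>b\<close> norming \<open>y\<close> and \<open>y'\<close>
  (\<open>norming_functional\<close>, a consequence of the Hahn--Banach theorem) nearly vanish at the other vectors, and the
  functional sending \<open>w\<^sup>N\<close> to \<open>b(w) a(w) ^ (N - 1)\<close> does the separation for every \<open>N\<close>
  (\<open>separated_powers\<close>). With \<open>y'\<close> alone and the \<open>N\<close>-th power of \<open>b\<close>, the sign would be lost
  for even \<open>N\<close>.
\<close>

section \<open>Polynomials on the unit interval\<close>

text \<open>
  A constant depending only on the degree suffices because \<open>r(p) - 2 ^ (d + 1) r(p/2)\<close> has smaller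
  degree, is still bounded on the unit interval, and keeps a multiple of the linear coefficient that
  is not smaller in absolute value, unless the degree is one.
\<close>

lemma linear_coeff_bound:
  "\<exists>C. \<forall>r::real poly. degree r \<le> d \<longrightarrow> (\<forall>p\<in>{0..1}. \<bar>poly r p\<bar> \<le> 1) \<longrightarrow> \<bar>coeff r 1\<bar> \<le> C"
proof (induction d)
  case 0
  show ?case by (intro exI[of _ 0]) (auto simp: coeff_eq_0)
next
  case (Suc d)
  then obtain C where C:
    "\<And>r::real poly. degree r \<le> d \<Longrightarrow> (\<forall>p\<in>{0..1}. \<bar>poly r p\<bar> \<le> 1) \<Longrightarrow> \<bar>coeff r 1\<bar> \<le> C" by blast
  show ?case
  proof (cases "d = 0")
    case True
    show ?thesis
    proof (intro exI[of _ 2] allI impI)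
      fix r :: "real poly"
      assume deg: "degree r \<le> Suc d" and bd: "\<forall>p\<in>{0..1}. \<bar>poly r p\<bar> \<le> 1"
      have "coeff r 1 = poly r 1 - poly r 0"
      proof -
        have "poly r 1 = (\<Sum>i\<le>1. coeff r i * 1 ^ i)"
          using deg True by (intro poly_as_sum_of_monoms'[of r 1, symmetric, THEN arg_cong, of "\<lambda>q. poly q 1", simplified poly_sum poly_monom]) simp
        then show ?thesis by (simp add: poly_0_coeff_0)
      qed
      moreover have "\<bar>poly r 1\<bar> \<le> 1" "\<bar>poly r 0\<bar> \<le> 1" using bd by auto
      ultimately show "\<bar>coeff r 1\<bar> \<le> 2" by linarith
    qed
  next
    case False
    define K where "K = (1 + 2 ^ Suc d :: real)"
    have K: "K > 0" unfolding K_def by (simp add: add_pos_pos)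
    show ?thesis
    proof (intro exI[of _ "K * C"] allI impI)
      fix r :: "real poly"
      assume deg: "degree r \<le> Suc d" and bd: "\<forall>p\<in>{0..1}. \<bar>poly r p\<bar> \<le> 1"
      \<comment> \<open>the coefficients of degree \<open>d + 1\<close> cancel; the linear one is multiplied by \<open>1 - 2 ^ d\<close>\<close>
      define s where "s = smult (1 / K) (r - smult (2 ^ Suc d) (r \<circ>\<^sub>p [:0, 1/2:]))"
      have coeff_s: "coeff s i = (1 - 2 ^ Suc d / 2 ^ i) * coeff r i / K" for i
        by (simp add: s_def coeff_pcompose_linear field_simps)
      have "degree s \<le> d"
      proof (rule degree_le, intro allI impI)
        fix i assume "d < i"
        then show "coeff s i = 0"
          using deg unfolding coeff_s by (cases "i = Suc d") (auto simp: coeff_eq_0)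
      qed
      moreover have "\<forall>p\<in>{0..1}. \<bar>poly s p\<bar> \<le> 1"
      proof
        fix p :: real assume "p \<in> {0..1}"
        then have "\<bar>poly r p\<bar> \<le> 1" "\<bar>poly r (p / 2)\<bar> \<le> 1" using bd by auto
        then have "\<bar>2 ^ Suc d * poly r (p / 2)\<bar> \<le> 2 ^ Suc d" by (simp add: abs_mult)
        with \<open>\<bar>poly r p\<bar> \<le> 1\<close> have "\<bar>poly r p - 2 ^ Suc d * poly r (p / 2)\<bar> \<le> K"
          unfolding K_def by linarith
        then show "\<bar>poly s p\<bar> \<le> 1"
          using K by (simp add: s_def poly_pcompose abs_mult field_simps)
      qed
      ultimately have "\<bar>coeff s 1\<bar> \<le> C" by (rule C)
      moreover have "\<bar>coeff r 1\<bar> \<le> K * \<bar>coeff s 1\<bar>"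
      proof -
        have "(2::real) ^ 1 \<le> 2 ^ d"
          using False by (intro power_increasing) auto
        then have "1 * \<bar>coeff r 1\<bar> \<le> \<bar>1 - 2 ^ d\<bar> * \<bar>coeff r 1\<bar>"
          by (intro mult_right_mono) auto
        also have "\<dots> = K * \<bar>coeff s 1\<bar>"
          using K unfolding coeff_s by (simp add: abs_mult)
        finally show ?thesis by simp
      qed
      ultimately show "\<bar>coeff r 1\<bar> \<le> K * C"
        using K by (meson less_imp_le mult_left_mono order.trans)
    qed
  qed
qed


section \<open>Functions of bounded polynomial degree\<close>

text \<open>
  Frechet's description of polynomials, by vanishing iterated differences: it makes sense on any
  vector space, and each difference costs one degree.
\<close>

fun degree_at_most :: "nat \<Rightarrow> ('a::real_vector \<Rightarrow> real) \<Rightarrow> bool" where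
  "degree_at_most 0 q \<longleftrightarrow> (\<forall>h x. q (x + h) - q x = 0)"
| "degree_at_most (Suc d) q \<longleftrightarrow> (\<forall>h. degree_at_most d (\<lambda>x. q (x + h) - q x))"

lemma degree_at_most_zero: "degree_at_most d (\<lambda>_. 0)"
  by (induction d) auto

lemma degree_at_most_add:
  "degree_at_most d q \<Longrightarrow> degree_at_most d q' \<Longrightarrow> degree_at_most d (\<lambda>x. q x + q' x)"
proof (induction d arbitrary: q q')
  case (Suc d)
  have "degree_at_most d (\<lambda>x. (q (x + h) - q x) + (q' (x + h) - q' x))" for h
    using Suc.prems by (intro Suc.IH) auto
  then show ?case by (simp add: algebra_simps)
qed (simp add: algebra_simps)

section \<open>Averages over random subset sums\<close>

text \<open>
  The expectation of \<open>q\<close> at \<open>x\<close> plus the sum of a random subset of \<open>ys\<close> that contains each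
  vector independently with probability \<open>p\<close>.
\<close>

fun random_sum_mean :: "real \<Rightarrow> 'a::real_vector list \<Rightarrow> ('a \<Rightarrow> real) \<Rightarrow> 'a \<Rightarrow> real" where
  "random_sum_mean p [] q x = q x"
| "random_sum_mean p (y # ys) q x =
     (1 - p) * random_sum_mean p ys q x + p * random_sum_mean p ys q (x + y)"

fun subset_sums_in_ball :: "'a::real_normed_vector \<Rightarrow> 'a list \<Rightarrow> bool" where
  "subset_sums_in_ball x [] \<longleftrightarrow> norm x < 1"
| "subset_sums_in_ball x (y # ys) \<longleftrightarrow> subset_sums_in_ball x ys \<and> subset_sums_in_ball (x + y) ys"

lemma subset_sums_in_ball_filter:
  "subset_sums_in_ball x ys \<Longrightarrow> subset_sums_in_ball x (filter Q ys)"
  by (induction ys arbitrary: x) auto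

lemma subset_sums_in_ball_base: "subset_sums_in_ball x ys \<Longrightarrow> norm x < 1"
  by (induction ys arbitrary: x) auto

lemma subset_sums_in_ball_member:
  "subset_sums_in_ball x ys \<Longrightarrow> y \<in> set ys \<Longrightarrow> norm (x + y) < 1"
  by (induction ys arbitrary: x) (auto dest: subset_sums_in_ball_base)

lemma random_sum_mean_bounded:
  assumes "\<And>x. norm x < 1 \<Longrightarrow> \<bar>q x\<bar> \<le> 1" "p \<in> {0..1}" "subset_sums_in_ball x ys"
  shows "\<bar>random_sum_mean p ys q x\<bar> \<le> 1"
  using assms(3)
proof (induction ys arbitrary: x)
  case (Cons y ys)
  let ?a = "random_sum_mean p ys q x" and ?b = "random_sum_mean p ys q (x + y)"
  have "\<bar>?a\<bar> \<le> 1" "\<bar>?b\<bar> \<le> 1" using Cons by auto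
  then have "(1 - p) * \<bar>?a\<bar> + p * \<bar>?b\<bar> \<le> 1"
    using assms(2) by (intro convex_bound_le) auto
  moreover have "\<bar>(1 - p) * ?a + p * ?b\<bar> \<le> (1 - p) * \<bar>?a\<bar> + p * \<bar>?b\<bar>"
    using assms(2) by (intro order.trans[OF abs_triangle_ineq]) (auto simp: abs_mult)
  ultimately show ?case by simp
qed (use assms(1) in auto)

lemma random_sum_mean_shift:
  "random_sum_mean p ys q (x + y) = random_sum_mean p ys (\<lambda>x. q (x + y)) x"
proof (induction ys arbitrary: x)
  case (Cons a ys)
  from Cons[of x] Cons[of "x + a"] show ?case by (simp add: add_ac)
qed simp

lemma random_sum_mean_diff:
  "random_sum_mean p ys (\<lambda>x. q x - q' x) x = random_sum_mean p ys q x - random_sum_mean p ys q' x"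
proof (induction ys arbitrary: x)
  case (Cons y ys)
  show ?case unfolding random_sum_mean.simps Cons by (simp add: algebra_simps)
qed simp

lemma random_sum_mean_zero: "random_sum_mean p ys (\<lambda>_. 0) x = 0"
  by (induction ys arbitrary: x) auto

text \<open>
  Putting \<open>y\<close> in front of the list adds \<open>p\<close> times the mean of the difference of \<open>q\<close> in the
  direction \<open>y\<close>. That difference has smaller degree, so the degree in \<open>p\<close> is bounded by the degree of
  \<open>q\<close>, however long the list is.
\<close>

lemma random_sum_mean_polynomial:
  assumes "degree_at_most d q"
  shows "\<exists>r. degree r \<le> d \<and> (\<forall>p. random_sum_mean p ys q x = poly r p) \<and>
    coeff r 0 = q x \<and> coeff r 1 = (\<Sum>y\<leftarrow>ys. q (x + y) - q x)"
  using assms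
proof (induction ys arbitrary: d q)
  case Nil
  show ?case by (intro exI[of _ "[:q x:]"]) auto
next
  case (Cons y ys)
  obtain r where r: "degree r \<le> d" "\<And>p. random_sum_mean p ys q x = poly r p"
    "coeff r 0 = q x" "coeff r 1 = (\<Sum>y\<leftarrow>ys. q (x + y) - q x)"
    using Cons.IH[OF Cons.prems] by blast
  define \<Delta> where "\<Delta> = (\<lambda>x. q (x + y) - q x)"
  have "\<exists>s. degree (pCons 0 s) \<le> d \<and> (\<forall>p. random_sum_mean p ys \<Delta> x = poly s p) \<and> coeff s 0 = \<Delta> x"
  proof (cases d)
    case 0
    then have "\<Delta> = (\<lambda>_. 0)" using Cons.prems by (auto simp: \<Delta>_def)
    then show ?thesis by (intro exI[of _ 0]) (auto simp: random_sum_mean_zero)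
  next
    case (Suc d')
    then have "degree_at_most d' \<Delta>" using Cons.prems by (auto simp: \<Delta>_def)
    from Cons.IH[OF this] obtain s where s: "degree s \<le> d'"
      "\<And>p. random_sum_mean p ys \<Delta> x = poly s p" "coeff s 0 = \<Delta> x" by blast
    then have "degree (pCons 0 s) \<le> d"
      using Suc by (auto intro: order.trans[OF degree_pCons_le])
    with s show ?thesis by blast
  qed
  then obtain s where s: "degree (pCons 0 s) \<le> d"
    "\<And>p. random_sum_mean p ys \<Delta> x = poly s p" "coeff s 0 = \<Delta> x" by blast
  have "random_sum_mean p (y # ys) q x = random_sum_mean p ys q x + p * random_sum_mean p ys \<Delta> x" for p
    unfolding \<Delta>_def random_sum_mean_diff
    by (simp add: random_sum_mean_shift algebra_simps)
  then have "random_sum_mean p (y # ys) q x = poly (r + pCons 0 s) p" for p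
    by (simp add: r s)
  moreover have "degree (r + pCons 0 s) \<le> d"
    using r(1) s(1) by (rule degree_add_le)
  moreover have "coeff (r + pCons 0 s) 0 = q x" by (simp add: r)
  moreover have "coeff (r + pCons 0 s) 1 = (\<Sum>y\<leftarrow>y # ys. q (x + y) - q x)"
    using s(3) r(4) by (simp add: \<Delta>_def)
  ultimately show ?case by blast
qed

text \<open>
  The sum is the derivative of the mean at \<open>p = 0\<close>, and the mean is bounded by 1 on the unit
  interval. The point is that the bound does not depend on the length of the list.
\<close>

lemma increments_sum_bounded:
  "\<exists>C. \<forall>q (x::'a::real_normed_vector) ys. degree_at_most d q \<longrightarrow> (\<forall>x. norm x < 1 \<longrightarrow> \<bar>q x\<bar> \<le> 1) \<longrightarrow>
     subset_sums_in_ball x ys \<longrightarrow> \<bar>\<Sum>y\<leftarrow>ys. q (x + y) - q x\<bar> \<le> C"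
proof -
  obtain C where C: "\<And>r::real poly. degree r \<le> d \<Longrightarrow> (\<forall>p\<in>{0..1}. \<bar>poly r p\<bar> \<le> 1) \<Longrightarrow> \<bar>coeff r 1\<bar> \<le> C"
    using linear_coeff_bound by blast
  show ?thesis
  proof (intro exI[of _ C] allI impI)
    fix q :: "'a \<Rightarrow> real" and x :: 'a and ys
    assume q: "degree_at_most d q" "\<forall>x. norm x < 1 \<longrightarrow> \<bar>q x\<bar> \<le> 1" and ys: "subset_sums_in_ball x ys"
    obtain r where r: "degree r \<le> d" "\<And>p. random_sum_mean p ys q x = poly r p"
      "coeff r 1 = (\<Sum>y\<leftarrow>ys. q (x + y) - q x)"
      using random_sum_mean_polynomial[OF q(1)] by metis
    have "\<forall>p\<in>{0..1}. \<bar>poly r p\<bar> \<le> 1"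
      unfolding r(2)[symmetric] using random_sum_mean_bounded q(2) ys by blast
    from C[OF r(1) this] show "\<bar>\<Sum>y\<leftarrow>ys. q (x + y) - q x\<bar> \<le> C"
      by (simp only: r(3))
  qed
qed

text \<open>
  The preceding bound, applied to those vectors alone along which \<open>q\<close> drops to \<open>\<beta>\<close>, leaves no
  room for many of them.
\<close>

lemma few_decreasing_increments:
  "\<exists>C. \<forall>q (x::'a::real_normed_vector) ys \<beta>. degree_at_most d q \<longrightarrow> (\<forall>x. norm x < 1 \<longrightarrow> \<bar>q x\<bar> \<le> 1) \<longrightarrow>
     subset_sums_in_ball x ys \<longrightarrow> real (length (filter (\<lambda>y. q (x + y) \<le> \<beta>) ys)) * (q x - \<beta>) \<le> C"
proof -
  obtain C where C: "\<And>q (x::'a) ys. degree_at_most d q \<Longrightarrow> (\<forall>x. norm x < 1 \<longrightarrow> \<bar>q x\<bar> \<le> 1) \<Longrightarrow>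
     subset_sums_in_ball x ys \<Longrightarrow> \<bar>\<Sum>y\<leftarrow>ys. q (x + y) - q x\<bar> \<le> C"
    using increments_sum_bounded by blast
  show ?thesis
  proof (intro exI[of _ C] allI impI)
    fix q :: "'a \<Rightarrow> real" and x :: 'a and ys \<beta>
    assume q: "degree_at_most d q" "\<forall>x. norm x < 1 \<longrightarrow> \<bar>q x\<bar> \<le> 1" and ys: "subset_sums_in_ball x ys"
    let ?zs = "filter (\<lambda>y. q (x + y) \<le> \<beta>) ys"
    have "(\<Sum>y\<leftarrow>?zs. q (x + y) - q x) \<le> (\<Sum>y\<leftarrow>?zs. \<beta> - q x)"
      by (rule sum_list_mono) auto
    also have "\<dots> = - (real (length ?zs) * (q x - \<beta>))"
      by (simp add: sum_list_triv algebra_simps)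
    finally show "real (length ?zs) * (q x - \<beta>) \<le> C"
      using C[OF q subset_sums_in_ball_filter[OF ys], of "\<lambda>y. q (x + y) \<le> \<beta>"] by linarith
  qed
qed


section \<open>Directions in an almost square space\<close>

text \<open>
  Shrinking the vectors a little turns the limits in the definition into strict inequalities, so that
  no error terms have to be carried through iterations.
\<close>

lemma almost_square_open_ball:
  fixes A :: "'a::real_normed_vector set"
  assumes asq: "almost_square TYPE('a)" and "finite A" and A: "A \<subseteq> ball 0 1"
    and \<eta>: "0 < \<eta>" "\<eta> < 1"
  obtains y where "1 - \<eta> < norm y" "norm y < 1" "\<And>a. a \<in> A \<Longrightarrow> norm (a + y) < 1 \<and> norm (a - y) < 1"
proof -
  define c where "c = 1 - \<eta> / 2"
  have c: "0 < c" "c < 1" "1 - \<eta> < c" using \<eta> by (auto simp: c_def)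
  have A1: "norm a < 1" if "a \<in> A" for a using A that by auto
  have "finite (sgn ` (A - {0}))" "sgn ` (A - {0}) \<subseteq> sphere 0 1"
    using \<open>finite A\<close> by (auto simp: norm_sgn split: if_splits)
  then obtain w :: "nat \<Rightarrow> 'a" where w: "\<And>m. norm (w m) = 1"
    and lim: "\<And>u. u \<in> sgn ` (A - {0}) \<Longrightarrow> (\<lambda>m. norm (u + w m)) \<longlonglongrightarrow> 1 \<and> (\<lambda>m. norm (u - w m)) \<longlonglongrightarrow> 1"
    using asq unfolding almost_square_def by (metis mem_sphere_0)
  have "\<forall>\<^sub>F m in sequentially. \<forall>a\<in>A - {0}. norm (sgn a + w m) < 2 - max (norm a) c \<and>
      norm (sgn a - w m) < 2 - max (norm a) c"
  proof (rule eventually_ball_finite)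
    show "finite (A - {0})" using \<open>finite A\<close> by simp
    show "\<forall>a\<in>A - {0}. \<forall>\<^sub>F m in sequentially. norm (sgn a + w m) < 2 - max (norm a) c \<and>
      norm (sgn a - w m) < 2 - max (norm a) c"
    proof
      fix a assume a: "a \<in> A - {0}"
      then have "1 < 2 - max (norm a) c" using A1 c by auto
      then show "\<forall>\<^sub>F m in sequentially. norm (sgn a + w m) < 2 - max (norm a) c \<and>
          norm (sgn a - w m) < 2 - max (norm a) c"
        using lim[of "sgn a"] a by (intro eventually_conj order_tendstoD(2)[of _ 1]) auto
    qed
  qed
  then obtain m where m: "\<And>a. a \<in> A - {0} \<Longrightarrow> norm (sgn a + w m) < 2 - max (norm a) c \<and>
      norm (sgn a - w m) < 2 - max (norm a) c"
    using eventually_happens'[OF sequentially_bot] by blast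
  \<comment> \<open>\<open>r u + c v\<close> is \<open>min r c\<close> times \<open>u + v\<close> plus a vector of norm \<open>\<bar>r - c\<bar>\<close>\<close>
  have convex: "norm (r *\<^sub>R u + c *\<^sub>R v) < 1"
    if "norm u = 1" "norm v = 1" "0 \<le> r" "r < 1" "norm (u + v) < 2 - max r c" for r and u v :: 'a
  proof -
    have "r *\<^sub>R u + c *\<^sub>R v = min r c *\<^sub>R (u + v) + ((r - min r c) *\<^sub>R u + (c - min r c) *\<^sub>R v)"
      by (simp add: algebra_simps)
    also have "norm \<dots> \<le> norm (min r c *\<^sub>R (u + v)) + (norm ((r - min r c) *\<^sub>R u) + norm ((c - min r c) *\<^sub>R v))"
      by (intro norm_triangle_le add_left_mono norm_triangle_ineq)
    also have "\<dots> = min r c * norm (u + v) + \<bar>r - c\<bar>"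
      using that c by (auto simp: min_def)
    finally have le: "norm (r *\<^sub>R u + c *\<^sub>R v) \<le> min r c * norm (u + v) + \<bar>r - c\<bar>" .
    show ?thesis
    proof (cases "min r c = 0")
      case True
      with le that c show ?thesis by (auto simp: min_def split: if_splits)
    next
      case False
      then have pos: "0 < min r c" using that c by auto
      then have "min r c * norm (u + v) < min r c * (2 - max r c)"
        using that by (intro mult_strict_left_mono) auto
      also have "\<dots> = min r c + min r c * (1 - max r c)" by (simp add: algebra_simps)
      also have "\<dots> \<le> min r c + 1 * (1 - max r c)"
        using that c by (intro add_left_mono mult_right_mono) auto
      finally show ?thesis using le by (auto simp: min_def max_def split: if_splits)
    qed
  qed
  show ?thesis
  proof (rule that[of "c *\<^sub>R w m"])
    show "1 - \<eta> < norm (c *\<^sub>R w m)" "norm (c *\<^sub>R w m) < 1" using c w by auto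
    fix a assume a: "a \<in> A"
    show "norm (a + c *\<^sub>R w m) < 1 \<and> norm (a - c *\<^sub>R w m) < 1"
    proof (cases "a = 0")
      case True
      then show ?thesis using c w by auto
    next
      case False
      then have u: "a = norm a *\<^sub>R sgn a" "norm (sgn a) = 1" by (auto simp: sgn_div_norm)
      have "norm (norm a *\<^sub>R sgn a + c *\<^sub>R w m) < 1" "norm (norm a *\<^sub>R sgn a + c *\<^sub>R (- w m)) < 1"
        using m[of a] a False A1[OF a] u w by (intro convex; simp)+
      then show ?thesis using u(1) by simp
    qed
  qed
qed

text \<open>
  Each new vector is almost square to all the sums of the previous ones, so that the list behaves
  like the first unit vectors of \<open>c\<^sub>0\<close>.
\<close>

lemma almost_square_list:
  fixes A :: "'a::real_normed_vector set"
  assumes asq: "almost_square TYPE('a)" and "finite A" and A: "A \<subseteq> ball 0 1"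
    and \<eta>: "0 < \<eta>" "\<eta> < 1"
  shows "\<exists>ys. length ys = M \<and> (\<forall>y\<in>set ys. 1 - \<eta> < norm y) \<and>
    (\<forall>x\<in>A. subset_sums_in_ball x ys \<and> subset_sums_in_ball x (map uminus ys))"
  using assms(2,3)
proof (induction M arbitrary: A)
  case 0
  then show ?case by auto
next
  case (Suc M)
  obtain y where y: "1 - \<eta> < norm y" "\<And>a. a \<in> A \<Longrightarrow> norm (a + y) < 1 \<and> norm (a - y) < 1"
    using almost_square_open_ball[OF asq Suc.prems \<eta>] by blast
  let ?B = "A \<union> (\<lambda>a. a + y) ` A \<union> (\<lambda>a. a - y) ` A"
  have "finite ?B" "?B \<subseteq> ball 0 1" using Suc.prems y by auto
  from Suc.IH[OF this] obtain ys where ys: "length ys = M" "\<forall>y\<in>set ys. 1 - \<eta> < norm y"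
    "\<forall>x\<in>?B. subset_sums_in_ball x ys \<and> subset_sums_in_ball x (map uminus ys)" by blast
  have "subset_sums_in_ball x (y # ys) \<and> subset_sums_in_ball x (map uminus (y # ys))" if "x \<in> A" for x
  proof -
    have "x \<in> ?B" "x + y \<in> ?B" "x - y \<in> ?B" using that by auto
    with ys(3) show ?thesis by auto
  qed
  with ys y(1) show ?case by (intro exI[of _ "y # ys"]) auto
qed

lemma length_le_sum_filter:
  assumes "finite I" "\<And>y. y \<in> set ys \<Longrightarrow> \<exists>i\<in>I. R i y"
  shows "length ys \<le> (\<Sum>i\<in>I. length (filter (R i) ys))"
  using assms(2)
proof (induction ys)
  case (Cons y ys)
  have "(\<Sum>i\<in>I. length (filter (R i) (y # ys))) =
      (\<Sum>i\<in>I. if R i y then 1 else 0) + (\<Sum>i\<in>I. length (filter (R i) ys))"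
    by (simp add: sum.distrib[symmetric] if_distrib cong: if_cong) (rule sum.cong, auto)
  moreover have "1 \<le> (\<Sum>i\<in>I. if R i y then 1 else (0::nat))"
  proof -
    obtain i where "i \<in> I" "R i y" using Cons.prems by auto
    then show ?thesis
      using member_le_sum[of i I "\<lambda>i. if R i y then 1 else (0::nat)"] assms(1) by simp
  qed
  moreover have "length ys \<le> (\<Sum>i\<in>I. length (filter (R i) ys))" using Cons by auto
  ultimately show ?case by simp
qed simp

lemma length_filter_disj_le:
  "length (filter (\<lambda>y. P y \<or> Q y) ys) \<le> length (filter P ys) + length (filter Q ys)"
  by (induction ys) auto

text \<open>
  In a long list behaving like the unit vectors of \<open>c\<^sub>0\<close>, only a bounded number of vectors \<open>y\<close> push
  some \<open>q i\<close> down to \<open>\<beta> i\<close> at \<open>x i + y\<close> or \<open>x i - y\<close>, so one vector is good for all \<open>i\<close> and both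
  signs. The set \<open>A\<close> collects further points to which this vector has to be almost square.
\<close>

lemma almost_square_direction:
  fixes x :: "'i \<Rightarrow> 'a::real_normed_vector" and q :: "'i \<Rightarrow> 'a \<Rightarrow> real"
  assumes asq: "almost_square TYPE('a)" and "finite A" and A: "A \<subseteq> ball 0 1"
    and \<eta>: "0 < \<eta>" "\<eta> < 1"
    and "finite I" and x: "\<And>i. i \<in> I \<Longrightarrow> norm (x i) < 1"
    and deg: "\<And>i. i \<in> I \<Longrightarrow> degree_at_most d (q i)"
    and bd: "\<And>i u. i \<in> I \<Longrightarrow> norm u < 1 \<Longrightarrow> \<bar>q i u\<bar> \<le> 1"
    and \<beta>: "\<And>i. i \<in> I \<Longrightarrow> \<beta> i < q i (x i)"
  obtains y where "1 - \<eta> < norm y" "norm y < 1" "\<And>a. a \<in> A \<Longrightarrow> norm (a + y) < 1 \<and> norm (a - y) < 1"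
    "\<And>i. i \<in> I \<Longrightarrow> \<beta> i < q i (x i + y) \<and> \<beta> i < q i (x i - y)"
proof -
  obtain C where C: "\<And>q (x::'a) ys \<beta>. degree_at_most d q \<Longrightarrow> (\<forall>x. norm x < 1 \<longrightarrow> \<bar>q x\<bar> \<le> 1) \<Longrightarrow>
     subset_sums_in_ball x ys \<Longrightarrow> real (length (filter (\<lambda>y. q (x + y) \<le> \<beta>) ys)) * (q x - \<beta>) \<le> C"
    using few_decreasing_increments by blast
  obtain M where M: "(\<Sum>i\<in>I. C / (q i (x i) - \<beta> i) + C / (q i (x i) - \<beta> i)) < real M"
    using reals_Archimedean2 by blast
  \<comment> \<open>the point 0 makes the new vectors themselves have norm less than 1\<close>
  have "finite (insert 0 (A \<union> x ` I))" "insert 0 (A \<union> x ` I) \<subseteq> ball 0 1"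
    using \<open>finite A\<close> \<open>finite I\<close> A x by auto
  from almost_square_list[OF asq this \<eta>, of M] obtain ys where
    ys: "length ys = M" "\<And>y. y \<in> set ys \<Longrightarrow> 1 - \<eta> < norm y"
    and sums: "\<And>x'. x' \<in> insert 0 (A \<union> x ` I) \<Longrightarrow> subset_sums_in_ball x' ys \<and> subset_sums_in_ball x' (map uminus ys)"
    by blast
  have "\<exists>y\<in>set ys. \<forall>i\<in>I. \<beta> i < q i (x i + y) \<and> \<beta> i < q i (x i - y)"
  proof (rule ccontr)
    assume "\<not> ?thesis"
    then have "\<exists>i\<in>I. q i (x i + y) \<le> \<beta> i \<or> q i (x i - y) \<le> \<beta> i" if "y \<in> set ys" for y
      using that by (force simp: not_less)
    then have "length ys \<le> (\<Sum>i\<in>I. length (filter (\<lambda>y. q i (x i + y) \<le> \<beta> i \<or> q i (x i - y) \<le> \<beta> i) ys))"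
      by (rule length_le_sum_filter[OF \<open>finite I\<close>])
    then have "real M \<le> real (\<Sum>i\<in>I. length (filter (\<lambda>y. q i (x i + y) \<le> \<beta> i \<or> q i (x i - y) \<le> \<beta> i) ys))"
      by (simp only: ys(1) of_nat_le_iff)
    also have "\<dots> = (\<Sum>i\<in>I. real (length (filter (\<lambda>y. q i (x i + y) \<le> \<beta> i \<or> q i (x i - y) \<le> \<beta> i) ys)))"
      by simp
    also have "\<dots> \<le> (\<Sum>i\<in>I. C / (q i (x i) - \<beta> i) + C / (q i (x i) - \<beta> i))"
    proof (rule sum_mono)
      fix i assume i: "i \<in> I"
      have pos: "0 < q i (x i) - \<beta> i" using \<beta>[OF i] by simp
      have plus: "real (length (filter (\<lambda>y. q i (x i + y) \<le> \<beta> i) ys)) * (q i (x i) - \<beta> i) \<le> C"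
        using C[OF deg[OF i], of "x i" ys "\<beta> i"] bd[OF i] sums[of "x i"] i by simp
      have "real (length (filter (\<lambda>y. q i (x i + y) \<le> \<beta> i) (map uminus ys))) * (q i (x i) - \<beta> i) \<le> C"
        using C[OF deg[OF i], of "x i" "map uminus ys" "\<beta> i"] bd[OF i] sums[of "x i"] i by simp
      then have minus: "real (length (filter (\<lambda>y. q i (x i - y) \<le> \<beta> i) ys)) * (q i (x i) - \<beta> i) \<le> C"
        by (simp add: filter_map o_def)
      have "real (length (filter (\<lambda>y. q i (x i + y) \<le> \<beta> i \<or> q i (x i - y) \<le> \<beta> i) ys)) \<le>
          real (length (filter (\<lambda>y. q i (x i + y) \<le> \<beta> i) ys)) + real (length (filter (\<lambda>y. q i (x i - y) \<le> \<beta> i) ys))"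
        unfolding of_nat_add[symmetric] of_nat_le_iff by (rule length_filter_disj_le)
      also have "\<dots> \<le> C / (q i (x i) - \<beta> i) + C / (q i (x i) - \<beta> i)"
        using plus minus by (intro add_mono; simp only: pos_le_divide_eq[OF pos])
      finally show "real (length (filter (\<lambda>y. q i (x i + y) \<le> \<beta> i \<or> q i (x i - y) \<le> \<beta> i) ys)) \<le>
          C / (q i (x i) - \<beta> i) + C / (q i (x i) - \<beta> i)" .
    qed
    finally show False using M by simp
  qed
  then obtain y where y: "y \<in> set ys" "\<And>i. i \<in> I \<Longrightarrow> \<beta> i < q i (x i + y) \<and> \<beta> i < q i (x i - y)"
    by blast
  have near: "norm (a + y) < 1 \<and> norm (a - y) < 1" if "a \<in> insert 0 (A \<union> x ` I)" for a
    using subset_sums_in_ball_member[of a ys y] subset_sums_in_ball_member[of a "map uminus ys" "- y"]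
      sums[OF that] y(1) by auto
  show ?thesis
    using ys(2)[OF y(1)] near[of 0] near y(2) by (intro that[of y]) auto
qed


section \<open>Norming functionals\<close>

definition sublinear :: "('a::real_vector \<Rightarrow> real) \<Rightarrow> bool" where
  "sublinear p \<longleftrightarrow> (\<forall>x y. p (x + y) \<le> p x + p y) \<and> (\<forall>c>0. \<forall>x. p (c *\<^sub>R x) \<le> c * p x)"

lemma sublinear_zero:
  assumes "sublinear p"
  shows "p 0 = 0"
proof -
  have "p (2 *\<^sub>R 0) \<le> 2 * p 0" "p ((1/2) *\<^sub>R 0) \<le> (1/2) * p 0"
    using assms unfolding sublinear_def by (metis zero_less_numeral, metis half_gt_zero zero_less_one)
  then show ?thesis by simp
qed

lemma sublinear_minus_le:
  assumes "sublinear p"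
  shows "- p (- x) \<le> p x"
proof -
  have "p (x + - x) \<le> p x + p (- x)"
    using assms unfolding sublinear_def by blast
  then show ?thesis
    using sublinear_zero[OF assms] by simp
qed

text \<open>
  Pushing a sublinear functional towards linearity along the direction \<open>a\<close>: the new functional is
  the largest sublinear one below \<open>p\<close> whose value at \<open>- a\<close> is at most \<open>- p a\<close>.
\<close>

definition straighten :: "('a::real_vector \<Rightarrow> real) \<Rightarrow> 'a \<Rightarrow> 'a \<Rightarrow> real" where
  "straighten p a x = (INF t\<in>{0..}. p (x + t *\<^sub>R a) - t * p a)"

lemma straighten_le:
  assumes p: "sublinear p" and "t \<ge> 0"
  shows "straighten p a x \<le> p (x + t *\<^sub>R a) - t * p a"
proof -
  have "- p (- x) \<le> p (x + s *\<^sub>R a) - s * p a" if "s \<ge> 0" for s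
  proof (cases "s = 0")
    case True
    then show ?thesis using sublinear_minus_le[OF p, of x] by simp
  next
    case False
    with that have s: "inverse s > 0" "s > 0" by auto
    have "p (inverse s *\<^sub>R (s *\<^sub>R a)) \<le> inverse s * p (s *\<^sub>R a)"
      using p s(1) unfolding sublinear_def by blast
    then have "s * p a \<le> p (s *\<^sub>R a)"
      using s by (simp add: field_simps)
    moreover have "p ((x + s *\<^sub>R a) + - x) \<le> p (x + s *\<^sub>R a) + p (- x)"
      using p unfolding sublinear_def by blast
    ultimately show ?thesis by simp
  qed
  then have "bdd_below ((\<lambda>t. p (x + t *\<^sub>R a) - t * p a) ` {0..})"
    by (intro bdd_belowI2[of _ "- p (- x)"]) auto
  then show ?thesis
    unfolding straighten_def by (rule cINF_lower) (use assms in auto)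
qed

lemma sublinear_straighten:
  assumes p: "sublinear p"
  shows "sublinear (straighten p a)"
  unfolding sublinear_def
proof (intro conjI allI impI)
  fix x y
  have *: "straighten p a (x + y) \<le> (p (x + s *\<^sub>R a) - s * p a) + (p (y + t *\<^sub>R a) - t * p a)"
    if "s \<ge> 0" "t \<ge> 0" for s t
  proof -
    have "straighten p a (x + y) \<le> p ((x + y) + (s + t) *\<^sub>R a) - (s + t) * p a"
      using that by (intro straighten_le p) auto
    moreover have "p ((x + s *\<^sub>R a) + (y + t *\<^sub>R a)) \<le> p (x + s *\<^sub>R a) + p (y + t *\<^sub>R a)"
      using p unfolding sublinear_def by blast
    ultimately show ?thesis by (simp add: algebra_simps)
  qed
  have "straighten p a (x + y) - (p (x + s *\<^sub>R a) - s * p a) \<le> straighten p a y" if "s \<ge> 0" for s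
    unfolding straighten_def[of p a y] using *[OF that] by (intro cINF_greatest) (auto simp: algebra_simps)
  then have "straighten p a (x + y) - straighten p a y \<le> straighten p a x"
    unfolding straighten_def[of p a x] by (intro cINF_greatest) (auto simp: algebra_simps)
  then show "straighten p a (x + y) \<le> straighten p a x + straighten p a y" by simp
next
  fix c :: real and x assume c: "c > 0"
  have "straighten p a (c *\<^sub>R x) / c \<le> p (x + t *\<^sub>R a) - t * p a" if "t \<ge> 0" for t
  proof -
    have "straighten p a (c *\<^sub>R x) \<le> p (c *\<^sub>R x + (c * t) *\<^sub>R a) - (c * t) * p a"
      using that c by (intro straighten_le p) auto
    also have "c *\<^sub>R x + (c * t) *\<^sub>R a = c *\<^sub>R (x + t *\<^sub>R a)"
      by (simp add: algebra_simps)
    also have "p (c *\<^sub>R (x + t *\<^sub>R a)) \<le> c * p (x + t *\<^sub>R a)"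
      using p c unfolding sublinear_def by blast
    finally show ?thesis using c by (simp add: field_simps)
  qed
  then have "straighten p a (c *\<^sub>R x) / c \<le> straighten p a x"
    unfolding straighten_def[of p a x] by (intro cINF_greatest) auto
  then show "straighten p a (c *\<^sub>R x) \<le> c * straighten p a x"
    using c by (simp add: field_simps)
qed

text \<open>
  This is the Hahn--Banach theorem: a pointwise minimal sublinear functional equals each of its straightenings, and
  this makes it additive; minimal ones exist by Zorn's lemma, since infima of chains are
  sublinear.
\<close>

lemma sublinear_dominates_linear:
  fixes p0 :: "'a::real_vector \<Rightarrow> real"
  assumes p0: "sublinear p0"
  obtains f where "linear f" "\<And>x. f x \<le> p0 x"
proof -
  define A where "A = {p. sublinear p \<and> (\<forall>x. p x \<le> p0 x)}"
  define P where "P p q \<longleftrightarrow> (\<forall>x. q x \<le> p x)" for p q :: "'a \<Rightarrow> real"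
  have "\<exists>m\<in>A. \<forall>a\<in>A. P m a \<longrightarrow> a = m"
  proof (rule predicate_Zorn)
    show "partial_order_on A (relation_of P A)"
      by (rule partial_order_on_relation_ofI) (auto simp: P_def fun_eq_iff intro: order.trans order.antisym)
  next
    fix C assume C: "C \<in> Chains (relation_of P A)"
    then have CA: "C \<subseteq> A" and chain: "\<And>p q. p \<in> C \<Longrightarrow> q \<in> C \<Longrightarrow> P p q \<or> P q p"
      by (auto simp: Chains_def relation_of_def)
    show "\<exists>u\<in>A. \<forall>a\<in>C. P a u"
    proof (cases "C = {}")
      case True
      then show ?thesis using p0 by (auto simp: A_def)
    next
      case False
      define u where "u x = (INF p\<in>C. p x)" for x
      have bdd: "bdd_below ((\<lambda>p. p x) ` C)" for x
      proof (rule bdd_belowI2)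
        fix p assume "p \<in> C"
        with CA have p: "sublinear p" "p (- x) \<le> p0 (- x)" by (auto simp: A_def)
        show "- p0 (- x) \<le> p x"
          using sublinear_minus_le[OF p(1), of x] p(2) by simp
      qed
      have u_le: "u x \<le> p x" if "p \<in> C" for p x
        unfolding u_def by (rule cINF_lower[OF bdd that])
      have u_ge: "c \<le> u x" if "\<And>p. p \<in> C \<Longrightarrow> c \<le> p x" for c x
        unfolding u_def using False that by (rule cINF_greatest)
      have "sublinear u"
        unfolding sublinear_def
      proof (intro conjI allI impI)
        fix x y
        have *: "u (x + y) \<le> p x + q y" if "p \<in> C" "q \<in> C" for p q
        proof -
          \<comment> \<open>the smaller of the two members of the chain bounds both terms\<close>
          have "\<exists>r\<in>C. r x \<le> p x \<and> r y \<le> q y"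
            using chain[OF that] that by (auto simp: P_def)
          then obtain r where r: "r \<in> C" "r x \<le> p x" "r y \<le> q y" by blast
          then have "r (x + y) \<le> r x + r y"
            using CA by (auto simp: A_def sublinear_def)
          with r u_le[OF r(1), of "x + y"] show ?thesis by linarith
        qed
        have "u (x + y) - p x \<le> u y" if "p \<in> C" for p
          using *[OF that] by (intro u_ge) (simp add: algebra_simps)
        then have "u (x + y) - u y \<le> u x"
          by (intro u_ge) (simp add: algebra_simps)
        then show "u (x + y) \<le> u x + u y" by simp
      next
        fix c :: real and x assume c: "c > 0"
        have "u (c *\<^sub>R x) / c \<le> p x" if "p \<in> C" for p
        proof -
          have "p (c *\<^sub>R x) \<le> c * p x"
            using that CA c by (auto simp: A_def sublinear_def)
          with u_le[OF that, of "c *\<^sub>R x"] c show ?thesis by (simp add: field_simps)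
        qed
        then have "u (c *\<^sub>R x) / c \<le> u x" by (rule u_ge)
        then show "u (c *\<^sub>R x) \<le> c * u x" using c by (simp add: field_simps)
      qed
      moreover have "u x \<le> p0 x" for x
        using False u_le CA unfolding A_def by (metis (mono_tags, lifting) all_not_in_conv mem_Collect_eq order.trans subsetD)
      ultimately show ?thesis
        using u_le by (auto simp: A_def P_def)
    qed
  qed
  then obtain f where f: "f \<in> A" and minimal: "\<And>q. q \<in> A \<Longrightarrow> P f q \<Longrightarrow> q = f" by blast
  then have sub: "sublinear f" and fp0: "\<And>x. f x \<le> p0 x" by (auto simp: A_def)
  have straight: "straighten f a = f" for a
  proof -
    have "straighten f a x \<le> f x" for x
      using straighten_le[OF sub, of 0 a x] by simp
    then show ?thesis
      using sublinear_straighten[OF sub, of a] fp0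
      by (intro minimal) (auto simp: A_def P_def intro: order.trans)
  qed
  have add: "f (x + a) = f x + f a" for x a
  proof (rule antisym)
    show "f (x + a) \<le> f x + f a" using sub by (simp add: sublinear_def)
    show "f x + f a \<le> f (x + a)"
      using straighten_le[OF sub, of 1 a x] by (simp add: straight)
  qed
  have neg: "f (- x) = - f x" for x
    using add[of x "- x"] sublinear_zero[OF sub] by simp
  have pos: "f (c *\<^sub>R x) = c * f x" if "c > 0" for c x
  proof (rule antisym)
    show "f (c *\<^sub>R x) \<le> c * f x" using sub that by (simp add: sublinear_def)
    have "f (c *\<^sub>R - x) \<le> c * f (- x)" using sub that unfolding sublinear_def by blast
    then show "c * f x \<le> f (c *\<^sub>R x)" by (simp add: neg)
  qed
  have "f (c *\<^sub>R x) = c * f x" for c x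
    using pos[of c x] pos[of "- c" x] sublinear_zero[OF sub] neg[of "c *\<^sub>R x"]
    by (cases c "0::real" rule: linorder_cases) auto
  with add have "linear f" by (intro linearI) auto
  with fp0 show ?thesis using that by blast
qed

text \<open>
  Straightening the norm along \<open>a\<close> first forces the dominated linear functional to attain the norm
  at \<open>a\<close>.
\<close>

lemma norming_functional:
  fixes a :: "'a::real_normed_vector"
  obtains f where "linear f" "\<And>x. \<bar>f x\<bar> \<le> norm x" "f a = norm a"
proof -
  have norm: "sublinear (norm :: 'a \<Rightarrow> real)"
    by (auto simp: sublinear_def norm_triangle_ineq)
  obtain f where f: "linear f" "\<And>x. f x \<le> straighten norm a x"
    using sublinear_dominates_linear[OF sublinear_straighten[OF norm]] by blast
  have le: "f x \<le> norm x" for x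
    using f(2)[of x] straighten_le[OF norm, of 0 a x] by simp
  have "f (- a) \<le> - norm a"
    using f(2)[of "- a"] straighten_le[OF norm, of 1 a "- a"] by simp
  with le[of a] have "f a = norm a"
    using linear_neg[OF f(1), of a] by simp
  moreover have "\<bar>f x\<bar> \<le> norm x" for x
    using le[of x] le[of "- x"] linear_neg[OF f(1), of x] by simp
  ultimately show ?thesis using that f(1) by blast
qed


section \<open>Functionals on tensor powers\<close>

definition multilinear :: "(('n \<Rightarrow> 'a::real_vector) \<Rightarrow> real) \<Rightarrow> bool" where
  "multilinear m \<longleftrightarrow> (\<forall>f i. linear (\<lambda>x. m (f(i := x))))"

lemma lookup_scaleR:
  fixes p :: "'k \<Rightarrow>\<^sub>0 real"
  shows "Poly_Mapping.lookup (c *\<^sub>R p) k = c * Poly_Mapping.lookup p k"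
proof -
  have "finite {i. c * Poly_Mapping.lookup p i \<noteq> 0}"
    by (rule finite_subset[OF _ finite_lookup[of p]]) auto
  then show ?thesis
    by (simp add: scaleR_poly_mapping_def Abs_poly_mapping_inverse)
qed

definition free_extension :: "('k \<Rightarrow> real) \<Rightarrow> ('k \<Rightarrow>\<^sub>0 real) \<Rightarrow> real" where
  "free_extension m p = (\<Sum>k\<in>Poly_Mapping.keys p. Poly_Mapping.lookup p k * m k)"

lemma free_extension_superset:
  assumes "finite K" "Poly_Mapping.keys p \<subseteq> K"
  shows "free_extension m p = (\<Sum>k\<in>K. Poly_Mapping.lookup p k * m k)"
  unfolding free_extension_def using assms
  by (intro sum.mono_neutral_left) (auto simp: in_keys_iff)

lemma linear_free_extension:
  fixes m :: "'k \<Rightarrow> real"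
  shows "linear (free_extension m)"
proof (rule linearI)
  fix p q :: "'k \<Rightarrow>\<^sub>0 real"
  let ?K = "Poly_Mapping.keys p \<union> Poly_Mapping.keys q"
  have "free_extension m (p + q) = (\<Sum>k\<in>?K. Poly_Mapping.lookup (p + q) k * m k)"
    using keys_add[of p q] by (intro free_extension_superset) auto
  also have "\<dots> = (\<Sum>k\<in>?K. Poly_Mapping.lookup p k * m k) + (\<Sum>k\<in>?K. Poly_Mapping.lookup q k * m k)"
    by (simp add: lookup_add distrib_right sum.distrib)
  also have "\<dots> = free_extension m p + free_extension m q"
    by (simp add: free_extension_superset[of ?K])
  finally show "free_extension m (p + q) = free_extension m p + free_extension m q" .
next
  fix c and p :: "'k \<Rightarrow>\<^sub>0 real"
  have "free_extension m (c *\<^sub>R p) = (\<Sum>k\<in>Poly_Mapping.keys p. Poly_Mapping.lookup (c *\<^sub>R p) k * m k)"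
    by (intro free_extension_superset) (auto simp: in_keys_iff lookup_scaleR)
  then show "free_extension m (c *\<^sub>R p) = c *\<^sub>R free_extension m p"
    by (simp add: free_extension_def lookup_scaleR sum_distrib_left mult.assoc)
qed

lemma free_extension_single: "free_extension m (Poly_Mapping.single k 1) = m k"
  by (simp add: free_extension_def)

lemma multilinear_factors_tensor:
  fixes m :: "('n \<Rightarrow> 'a::real_vector) \<Rightarrow> real"
  assumes m: "multilinear m"
  obtains L :: "('a, 'n) tensor_power \<Rightarrow> real" where "linear L" "\<And>f. L (tensor f) = m f"
proof -
  note lin = linear_free_extension[of m]
  have "m (f(i := x + y)) = m (f(i := x)) + m (f(i := y))"
    and "m (f(i := c *\<^sub>R x)) = c * m (f(i := x))" for f i x y c
    using m linear_add[of "\<lambda>x. m (f(i := x))"] linear_scale[of "\<lambda>x. m (f(i := x))"]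
    unfolding multilinear_def by auto
  then have "free_extension m p = 0" if "p \<in> multilinearity_relations" for p
    using that unfolding multilinearity_relations_def
    by (auto simp: linear_diff[OF lin] linear_scale[OF lin] free_extension_single)
  then have zero: "free_extension m p = 0" if "p \<in> span multilinearity_relations" for p
    using linear_eq_0_on_span[OF lin _ that] by blast
  have cong: "free_extension m p = free_extension m q" if "tensor_rel p q" for p q
    using zero that linear_diff[OF lin, of p q] unfolding tensor_rel_def by simp
  define L where "L t = free_extension m (rep_tensor_power t)" for t
  have L: "L (abs_tensor_power p) = free_extension m p" for p
    unfolding L_def by (rule cong) (metis Quotient_rep_abs Quotient_tensor_power equivp_reflp equivp_tensor_rel)
  have "linear L"
  proof (rule linearI)
    fix s t :: "('a, 'n) tensor_power"
    show "L (s + t) = L s + L t"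
      by (induction s; induction t) (simp add: plus_tensor_power.abs_eq L linear_add[OF lin])
    fix c show "L (c *\<^sub>R s) = c *\<^sub>R L s"
      by (induction s) (simp add: scaleR_tensor_power.abs_eq L linear_scale[OF lin])
  qed
  moreover have "L (tensor f) = m f" for f
    by (simp add: tensor.abs_eq L free_extension_single)
  ultimately show ?thesis using that by blast
qed

text \<open>
  The increment of a product of affine slots telescopes: replacing the slots one by one leaves,
  in each step, one slot constant, so the number of nonconstant slots drops by one.
\<close>

lemma degree_tensor_slots:
  fixes L :: "('a::real_vector, 'n) tensor_power \<Rightarrow> real"
  assumes L: "linear L"
  shows "finite A \<Longrightarrow> card A = d \<Longrightarrow>
    degree_at_most d (\<lambda>x. L (tensor (\<lambda>i. if i \<in> A then f i + x else f i)))"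
proof (induction d arbitrary: A f)
  case 0
  then show ?case by auto
next
  case (Suc d)
  let ?T = "\<lambda>C h x. L (tensor (\<lambda>i. if i \<in> A then (if i \<in> C then f i + h else f i) + x else f i))"
  have "degree_at_most d (\<lambda>x. ?T C h x - ?T {} h x)" if "finite C" "C \<subseteq> A" for C h
    using that
  proof (induction C rule: finite_induct)
    case empty
    show ?case by (simp add: degree_at_most_zero)
  next
    case (insert a C)
    define g where "g = (\<lambda>i. if i \<in> C then f i + h else f i)(a := h)"
    have "?T (insert a C) h x - ?T C h x = L (tensor (\<lambda>i. if i \<in> A - {a} then g i + x else g i))" for x
    proof -
      let ?u = "\<lambda>i. if i \<in> A then (if i \<in> C then f i + h else f i) + x else f i"
      have a: "a \<in> A" "a \<notin> C" using insert by auto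
      have "(\<lambda>i. if i \<in> A then (if i \<in> insert a C then f i + h else f i) + x else f i)
          = ?u(a := (f a + x) + h)"
        using a by (auto simp: fun_eq_iff)
      then have "?T (insert a C) h x = L (tensor (?u(a := f a + x))) + L (tensor (?u(a := h)))"
        by (simp only: tensor_add linear_add[OF L])
      moreover have "?u(a := f a + x) = ?u" using a by (auto simp: fun_eq_iff)
      moreover have "?u(a := h) = (\<lambda>i. if i \<in> A - {a} then g i + x else g i)"
        using insert.prems a by (auto simp: fun_eq_iff g_def)
      ultimately show ?thesis by simp
    qed
    moreover have "degree_at_most d (\<lambda>x. L (tensor (\<lambda>i. if i \<in> A - {a} then g i + x else g i)))"
      using Suc.prems insert.prems by (intro Suc.IH) auto
    ultimately have "degree_at_most d (\<lambda>x. ?T (insert a C) h x - ?T C h x)" by simp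
    from degree_at_most_add[OF this insert.IH] show ?case
      using insert.prems by simp
  qed
  from this[OF Suc.prems(1) order.refl]
  show ?case
    by (simp add: algebra_simps cong: if_cong)
qed

text \<open>
  A functional on symmetric tensors is the restriction of one on the whole tensor power, where the
  slots can be changed separately.
\<close>

lemma degree_sym_power:
  fixes F :: "('a::real_normed_vector, 'n::finite) sym_tensor \<Rightarrow> real"
  assumes F: "linear F"
  shows "degree_at_most CARD('n) (\<lambda>x. F (sym_power x))"
proof -
  have "linear (Rep_sym_tensor :: ('a, 'n) sym_tensor \<Rightarrow> _)"
    by (rule linearI) (simp_all add: plus_sym_tensor.rep_eq scaleR_sym_tensor.rep_eq)
  moreover have "inj (Rep_sym_tensor :: ('a, 'n) sym_tensor \<Rightarrow> _)"
    by (simp add: inj_def Rep_sym_tensor_inject)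
  ultimately obtain g where g: "linear g" "g \<circ> Rep_sym_tensor = (id :: ('a, 'n) sym_tensor \<Rightarrow> _)"
    using linear_injective_left_inverse by blast
  have "linear (F \<circ> g)" using g(1) F by (rule linear_compose)
  from degree_tensor_slots[OF this, of "UNIV :: 'n set" "CARD('n)" "\<lambda>_. 0"]
  have "degree_at_most CARD('n) (\<lambda>x. F (g (tensor (\<lambda>_::'n. x))))" by simp
  moreover have "g (tensor (\<lambda>_::'n. x)) = sym_power x" for x
    using g(2) by (simp add: fun_eq_iff sym_power.rep_eq[symmetric])
  ultimately show ?thesis by simp
qed

text \<open>
  The simple tensor of functionals that has \<open>b\<close> in the slot \<open>j\<close> and \<open>a\<close> in all others.
\<close>

definition power_functional :: "('a::real_vector \<Rightarrow> real) \<Rightarrow> ('a \<Rightarrow> real) \<Rightarrow> 'n::finite \<Rightarrow> ('n \<Rightarrow> 'a) \<Rightarrow> real" where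
  "power_functional a b j f = b (f j) * (\<Prod>i\<in>UNIV - {j}. a (f i))"

lemma multilinear_power_functional:
  assumes "linear a" "linear b"
  shows "multilinear (power_functional a b j)"
  unfolding multilinear_def
proof (intro allI)
  fix f :: "'b \<Rightarrow> 'a" and i
  show "linear (\<lambda>x. power_functional a b j (f(i := x)))"
  proof (cases "i = j")
    case True
    then have "power_functional a b j (f(i := x)) = b x * (\<Prod>i\<in>UNIV - {j}. a (f i))" for x
      by (simp add: power_functional_def)
    then show ?thesis
      by (intro linearI) (simp_all add: linear_add[OF assms(2)] linear_scale[OF assms(2)] algebra_simps)
  next
    case False
    have "power_functional a b j (f(i := x)) = b (f j) * (a x * (\<Prod>i\<in>UNIV - {j} - {i}. a (f i)))" for x
      using False by (simp add: power_functional_def prod.remove[of _ i])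
    then show ?thesis
      by (intro linearI) (simp_all add: linear_add[OF assms(1)] linear_scale[OF assms(1)] algebra_simps)
  qed
qed


lemma sym_norm_dominates:
  fixes F :: "('a::real_normed_vector, 'n::finite) sym_tensor \<Rightarrow> real"
  assumes F: "linear F" and bound: "\<And>x. norm x = 1 \<Longrightarrow> \<bar>F (sym_power x)\<bar> \<le> c"
  shows "\<bar>F z\<bar> \<le> c * sym_norm z"
proof -
  have *: "\<bar>F z\<bar> \<le> c * s" if s: "s \<in> sym_representation_sums z" for s
  proof -
    obtain k l x where x: "\<forall>i<(k::nat). x i \<in> sphere (0::'a) 1"
      and z: "z = (\<Sum>i<k. l i *\<^sub>R sym_power (x i))" and s: "s = (\<Sum>i<k. \<bar>l i\<bar>)"
      using s unfolding sym_representation_sums_def by blast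
    have "\<bar>F z\<bar> = \<bar>\<Sum>i<k. l i * F (sym_power (x i))\<bar>"
      by (simp add: z linear_sum[OF F] linear_scale[OF F])
    also have "\<dots> \<le> (\<Sum>i<k. \<bar>l i * F (sym_power (x i))\<bar>)" by (rule sum_abs)
    also have "\<dots> \<le> (\<Sum>i<k. c * \<bar>l i\<bar>)"
    proof (rule sum_mono)
      fix i assume "i \<in> {..<k}"
      then have "\<bar>F (sym_power (x i))\<bar> \<le> c" using x by (intro bound) auto
      then show "\<bar>l i * F (sym_power (x i))\<bar> \<le> c * \<bar>l i\<bar>"
        by (simp add: abs_mult mult.commute[of c] mult_left_mono)
    qed
    finally show ?thesis by (simp add: s sum_distrib_left)
  qed
  show ?thesis
  proof (rule field_le_epsilon)
    fix e :: real assume e: "e > 0"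
    \<comment> \<open>the added 1 avoids a division by zero, and the absolute value a case distinction on the sign of \<open>c\<close>\<close>
    define \<delta> where "\<delta> = e / (\<bar>c\<bar> + 1)"
    have \<delta>: "\<delta> > 0" "\<bar>c\<bar> * \<delta> \<le> e" using e by (auto simp: \<delta>_def field_simps add_pos_nonneg)
    obtain s where s: "s \<in> sym_representation_sums z" "s < sym_norm z + \<delta>"
      using sym_norm_less_obtain[OF \<delta>(1)] by metis
    have "sym_norm z \<le> s" using s(1) by (rule sym_norm_le)
    have "c * s - c * sym_norm z \<le> \<bar>c\<bar> * (s - sym_norm z)"
      using \<open>sym_norm z \<le> s\<close> by (simp add: right_diff_distrib[symmetric] mult_right_mono)
    also have "\<dots> \<le> \<bar>c\<bar> * \<delta>" using s(2) by (intro mult_left_mono) auto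
    finally show "\<bar>F z\<bar> \<le> c * sym_norm z + e" using *[OF s(1)] \<delta>(2) by linarith
  qed
qed

lemma sym_norm_sym_power_le:
  "sym_norm (sym_power x :: ('a::real_normed_vector, 'n::finite) sym_tensor) \<le> norm x ^ CARD('n)"
  by (rule sym_norm_le[OF sym_representation_sums_sym_power])

text \<open>
  On symmetric tensors the slot chosen for \<open>b\<close> does not matter.
\<close>

lemma sym_functional:
  fixes a b :: "'a::real_normed_vector \<Rightarrow> real"
  assumes a: "linear a" "\<And>x. \<bar>a x\<bar> \<le> norm x" and b: "linear b" "\<And>x. \<bar>b x\<bar> \<le> norm x"
  obtains F :: "('a, 'n::finite) sym_tensor \<Rightarrow> real" where "linear F"
    "\<And>x. F (sym_power x) = b x * a x ^ (CARD('n) - 1)" "\<And>z. \<bar>F z\<bar> \<le> sym_norm z"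
proof -
  obtain j :: 'n where True by simp
  obtain L :: "('a, 'n) tensor_power \<Rightarrow> real" where L: "linear L"
    "\<And>f. L (tensor f) = power_functional a b j f"
    using multilinear_factors_tensor[OF multilinear_power_functional[OF a(1) b(1)]] by blast
  define F where "F z = L (Rep_sym_tensor z)" for z :: "('a, 'n) sym_tensor"
  have F: "linear F"
    by (rule linearI) (simp_all add: F_def plus_sym_tensor.rep_eq scaleR_sym_tensor.rep_eq
        linear_add[OF L(1)] linear_scale[OF L(1)])
  have power: "F (sym_power x) = b x * a x ^ (CARD('n) - 1)" for x
    by (simp add: F_def sym_power.rep_eq L(2) power_functional_def card_Diff_singleton)
  have "\<bar>F (sym_power x)\<bar> \<le> 1" if "norm x = 1" for x
    using a(2)[of x] b(2)[of x] that
    by (simp add: power abs_mult power_abs mult_le_one power_le_one)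
  from sym_norm_dominates[OF F this] have "\<bar>F z\<bar> \<le> sym_norm z" for z by simp
  with F power show ?thesis using that by blast
qed


section \<open>Tensor powers in slices\<close>

lemma sym_norm_sym_power_le_one:
  fixes x :: "'a::real_normed_vector"
  assumes "norm x < 1"
  shows "sym_norm (sym_power x :: ('a, 'n::finite) sym_tensor) \<le> 1"
  using sym_norm_sym_power_le[of x, where 'n = 'n] assms
  by (meson less_imp_le norm_ge_zero order.trans power_le_one)

text \<open>
  Otherwise \<open>\<bar>f\<bar>\<close> is at most \<open>1 - \<alpha>\<close> at the powers of all unit vectors, by homogeneity and passage
  to the limit. By the definition of the projective norm and density, the norm of \<open>f\<close> is then at most
  \<open>1 - \<alpha>\<close>, which is less than 1.
\<close>

lemma unit_functional_near_power:
  fixes f :: "('a::real_normed_vector, 'n::finite) sym_proj_tensor \<Rightarrow>\<^sub>L real"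
  assumes f: "norm f = 1" and \<alpha>: "\<alpha> > 0"
  obtains x \<sigma> where "norm x < 1" "\<sigma> = 1 \<or> \<sigma> = -1" "1 - \<alpha> < \<sigma> * f (of_sym_tensor (sym_power x))"
proof -
  define F where "F z = f (of_sym_tensor z)" for z
  have F: "linear F"
    by (rule linearI) (simp_all add: F_def linear_add[OF linear_of_sym_tensor]
        linear_scale[OF linear_of_sym_tensor] blinfun.add_right blinfun.scaleR_right)
  have "\<exists>x. norm x < 1 \<and> 1 - \<alpha> < \<bar>F (sym_power x)\<bar>"
  proof (rule ccontr)
    assume "\<not> ?thesis"
    then have open_ball: "\<bar>F (sym_power x)\<bar> \<le> 1 - \<alpha>" if "norm x < 1" for x
      using that by (metis not_less)
    have sphere: "\<bar>F (sym_power x)\<bar> \<le> 1 - \<alpha>" if "norm x = 1" for x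
    proof -
      have "((\<lambda>t. t ^ CARD('n) * \<bar>F (sym_power x)\<bar>) \<longlongrightarrow> 1 ^ CARD('n) * \<bar>F (sym_power x)\<bar>) (at_left 1)"
        by (intro tendsto_intros)
      moreover have "\<forall>\<^sub>F t in at_left 1. t ^ CARD('n) * \<bar>F (sym_power x)\<bar> \<le> 1 - \<alpha>"
      proof (rule eventually_mono[OF eventually_at_left_real[of 0 1]])
        fix t :: real assume t: "t \<in> {0<..<1}"
        with that open_ball[of "t *\<^sub>R x"] show "t ^ CARD('n) * \<bar>F (sym_power x)\<bar> \<le> 1 - \<alpha>"
          by (simp add: sym_power_scaleR linear_scale[OF F] abs_mult)
      qed simp
      ultimately have "1 ^ CARD('n) * \<bar>F (sym_power x)\<bar> \<le> 1 - \<alpha>"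
        by (rule tendsto_upperbound) simp
      then show ?thesis by simp
    qed
    have closed: "closed {y. \<bar>f y\<bar> \<le> (1 - \<alpha>) * norm y}"
      by (intro closed_Collect_le continuous_intros)
    have "range of_sym_tensor \<subseteq> {y. \<bar>f y\<bar> \<le> (1 - \<alpha>) * norm y}"
      using sym_norm_dominates[OF F sphere] by (auto simp: F_def norm_of_sym_tensor)
    from closure_minimal[OF this closed] have le: "\<bar>f y\<bar> \<le> (1 - \<alpha>) * norm y" for y
      unfolding closure_range_of_sym_tensor by blast
    have "0 \<le> 1 - \<alpha>"
      using open_ball[of 0] abs_ge_zero[of "F (sym_power 0)"] by simp
    then have "norm f \<le> 1 - \<alpha>"
      by (rule norm_blinfun_bound) (simp add: le)
    with f \<alpha> show False by simp
  qed
  then obtain x where x: "norm x < 1" "1 - \<alpha> < \<bar>F (sym_power x)\<bar>" by blast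
  show ?thesis
  proof (cases "F (sym_power x) \<ge> 0")
    case True
    then show ?thesis using x that[of x 1] by (simp add: F_def)
  next
    case False
    then show ?thesis using x that[of x "-1"] by (simp add: F_def)
  qed
qed


section \<open>Separated tensor powers\<close>

text \<open>
  Here \<open>u i = x i + y + \<sigma> i y'\<close> and \<open>v i = x i + y - \<sigma> i y'\<close>, with \<open>y\<close> almost square to the \<open>x i\<close>, and
  \<open>y'\<close> almost square to \<open>y\<close> and to the \<open>x i + y\<close>. With \<open>a\<close> and \<open>b\<close> norming \<open>y\<close> and \<open>y'\<close>, the functional
  given by \<open>b(w) a(w) ^ (N - 1)\<close> on powers is nearly \<open>\<plusminus>1\<close> at them. It is linear in \<open>b\<close>, hence changes
  sign with the direction \<open>y'\<close> whether \<open>N\<close> is even or odd.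
\<close>

lemma separated_powers:
  fixes x :: "'i \<Rightarrow> 'a::real_normed_vector"
    and G :: "'i \<Rightarrow> ('a, 'n::finite) sym_tensor \<Rightarrow> real"
  assumes asq: "almost_square TYPE('a)" and I: "finite I"
    and x: "\<And>i. i \<in> I \<Longrightarrow> norm (x i) < 1"
    and G: "\<And>i. i \<in> I \<Longrightarrow> linear (G i)" "\<And>i z. i \<in> I \<Longrightarrow> \<bar>G i z\<bar> \<le> sym_norm z"
    and \<beta>: "\<And>i. i \<in> I \<Longrightarrow> \<beta> i < G i (sym_power (x i))"
    and \<sigma>: "\<And>i. i \<in> I \<Longrightarrow> \<sigma> i = 1 \<or> \<sigma> i = (-1::real)"
    and \<eta>: "0 < \<eta>" "\<eta> < 1/3"
  obtains u v :: "'i \<Rightarrow> 'a" and F :: "('a, 'n) sym_tensor \<Rightarrow> real" where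
    "\<And>i. i \<in> I \<Longrightarrow> norm (u i) < 1 \<and> \<beta> i < G i (sym_power (u i))"
    "\<And>i. i \<in> I \<Longrightarrow> norm (v i) < 1 \<and> \<beta> i < G i (sym_power (v i))"
    "linear F" "\<And>z. \<bar>F z\<bar> \<le> sym_norm z"
    "\<And>i. i \<in> I \<Longrightarrow> (1 - 3 * \<eta>) ^ CARD('n) \<le> \<sigma> i * F (sym_power (u i))"
    "\<And>i. i \<in> I \<Longrightarrow> \<sigma> i * F (sym_power (v i)) \<le> - ((1 - 3 * \<eta>) ^ CARD('n))"
proof -
  define q where "q i w = G i (sym_power w)" for i w
  have deg: "degree_at_most CARD('n) (q i)" if "i \<in> I" for i
    unfolding q_def by (rule degree_sym_power[OF G(1)[OF that]])
  have bd: "\<bar>q i w\<bar> \<le> 1" if "i \<in> I" "norm w < 1" for i w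
    using G(2)[OF that(1), of "sym_power w"] sym_norm_sym_power_le_one[OF that(2), where 'n = 'n]
    by (simp add: q_def)
  have xI: "finite (x ` I)" "x ` I \<subseteq> ball 0 1" using I x by auto
  have \<beta>x: "\<beta> i < q i (x i)" if "i \<in> I" for i using \<beta>[OF that] by (simp add: q_def)
  have \<eta>1: "\<eta> < 1" using \<eta> by simp
  obtain y where y: "1 - \<eta> < norm y" "norm y < 1"
    and xy: "\<And>a. a \<in> x ` I \<Longrightarrow> norm (a + y) < 1 \<and> norm (a - y) < 1"
    and \<beta>y: "\<And>i. i \<in> I \<Longrightarrow> \<beta> i < q i (x i + y) \<and> \<beta> i < q i (x i - y)"
    by (rule almost_square_direction[where x = x and q = q and \<beta> = \<beta>, OF asq xI \<eta>(1) \<eta>1 I x deg bd \<beta>x]) (assumption | rule that)+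
  let ?A = "insert y ((\<lambda>i. x i + y) ` I)"
  have A: "finite ?A" "?A \<subseteq> ball 0 1" using I y xy by auto
  have xy1: "norm (x i + y) < 1" and \<beta>y1: "\<beta> i < q i (x i + y)" if "i \<in> I" for i
    using xy \<beta>y that by auto
  obtain y' where y': "1 - \<eta> < norm y'" "norm y' < 1"
    and xy': "\<And>a. a \<in> ?A \<Longrightarrow> norm (a + y') < 1 \<and> norm (a - y') < 1"
    and \<beta>y': "\<And>i. i \<in> I \<Longrightarrow> \<beta> i < q i (x i + y + y') \<and> \<beta> i < q i (x i + y - y')"
    by (rule almost_square_direction[where x = "\<lambda>i. x i + y" and q = q and \<beta> = \<beta>, OF asq A \<eta>(1) \<eta>1 I xy1 deg bd \<beta>y1]) (assumption | rule that)+
  obtain a where a: "linear a" "\<And>w. \<bar>a w\<bar> \<le> norm w" "a y = norm y"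
    using norming_functional[of y] by blast
  obtain b where b: "linear b" "\<And>w. \<bar>b w\<bar> \<le> norm w" "b y' = norm y'"
    using norming_functional[of y'] by blast
  \<comment> \<open>a functional norming \<open>w'\<close> nearly vanishes at vectors that are almost square to \<open>w'\<close>\<close>
  have small: "\<bar>g w\<bar> < \<eta>" if g: "linear g" "\<And>w. \<bar>g w\<bar> \<le> norm w" "g w' = norm w'"
    and w: "1 - \<eta> < norm w'" "norm (w + w') < 1" "norm (w - w') < 1" for g and w w' :: 'a
    using g(2)[of "w + w'"] g(2)[of "w - w'"] w
    by (simp add: linear_add[OF g(1)] linear_diff[OF g(1)] g(3))
  have ax: "\<bar>a (x i)\<bar> < \<eta>" if "i \<in> I" for i
    using xy[of "x i"] that by (intro small[OF a y(1)]) auto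
  have ay': "\<bar>a y'\<bar> < \<eta>"
    using xy'[of y] by (intro small[OF a y(1)]) (auto simp: add.commute norm_minus_commute)
  have bx: "\<bar>b (x i + y)\<bar> < \<eta>" if "i \<in> I" for i
    using xy'[of "x i + y"] that by (intro small[OF b y'(1)]) auto
  obtain F :: "('a, 'n) sym_tensor \<Rightarrow> real" where F: "linear F" "\<And>z. \<bar>F z\<bar> \<le> sym_norm z"
    and F_power: "\<And>w. F (sym_power w) = b w * a w ^ (CARD('n) - 1)"
    by (rule sym_functional[OF a(1,2) b(1,2)]) (assumption | rule that)+
  have estimate: "(1 - 3 * \<eta>) ^ CARD('n) \<le> \<tau> * F (sym_power (x i + y + \<tau> *\<^sub>R y'))"
    if i: "i \<in> I" and \<tau>: "\<tau> = 1 \<or> \<tau> = -1" for i \<tau>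
  proof -
    let ?w = "x i + y + \<tau> *\<^sub>R y'"
    have "a ?w = a (x i) + norm y + \<tau> * a y'"
      by (simp add: linear_add[OF a(1)] linear_scale[OF a(1)] a(3))
    then have aw: "1 - 3 * \<eta> \<le> a ?w" using ax[OF i] ay' y(1) \<tau> by auto
    have "b ?w = b (x i + y) + \<tau> * norm y'"
      by (simp add: linear_add[OF b(1), of _ "\<tau> *\<^sub>R y'"] linear_scale[OF b(1)] b(3))
    then have bw: "1 - 3 * \<eta> \<le> \<tau> * b ?w" using bx[OF i] y'(1) \<tau> \<eta> by auto
    have "(1 - 3 * \<eta>) ^ CARD('n) = (1 - 3 * \<eta>) * (1 - 3 * \<eta>) ^ (CARD('n) - 1)"
      by (metis One_nat_def Suc_pred power_Suc zero_less_card_finite)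
    also have "\<dots> \<le> (\<tau> * b ?w) * a ?w ^ (CARD('n) - 1)"
      using aw bw \<eta> by (intro mult_mono power_mono) auto
    finally show ?thesis by (simp add: F_power mult.assoc)
  qed
  show ?thesis
  proof (rule that[of "\<lambda>i. x i + y + \<sigma> i *\<^sub>R y'" "\<lambda>i. x i + y + (- \<sigma> i) *\<^sub>R y'" F])
    fix i assume i: "i \<in> I"
    have "norm (x i + y + y') < 1 \<and> norm (x i + y - y') < 1" using xy' i by auto
    then show "norm (x i + y + \<sigma> i *\<^sub>R y') < 1 \<and> \<beta> i < G i (sym_power (x i + y + \<sigma> i *\<^sub>R y'))"
      "norm (x i + y + (- \<sigma> i) *\<^sub>R y') < 1 \<and> \<beta> i < G i (sym_power (x i + y + (- \<sigma> i) *\<^sub>R y'))"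
      using \<beta>y'[OF i] \<sigma>[OF i] by (auto simp: q_def)
    show "(1 - 3 * \<eta>) ^ CARD('n) \<le> \<sigma> i * F (sym_power (x i + y + \<sigma> i *\<^sub>R y'))"
      using estimate[OF i \<sigma>[OF i]] .
    show "\<sigma> i * F (sym_power (x i + y + (- \<sigma> i) *\<^sub>R y')) \<le> - ((1 - 3 * \<eta>) ^ CARD('n))"
      using estimate[OF i, of "- \<sigma> i"] \<sigma>[OF i] by auto
  qed (use F in auto)
qed


section \<open>Convex combinations of slices\<close>

text \<open>
  The sign \<open>\<sigma> i\<close> with which the power of \<open>x i\<close> lies in the slice enters the choice of \<open>u i\<close> and \<open>v i\<close>,
  so that the values of the separating functional add up instead of cancelling.
\<close>

lemma almost_square_imp_distance:
  fixes l :: "nat \<Rightarrow> real" and f :: "nat \<Rightarrow> ('a::real_normed_vector, 'n::finite) sym_proj_tensor \<Rightarrow>\<^sub>L real"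
  assumes asq: "almost_square TYPE('a)"
    and f: "\<And>i. i < k \<Longrightarrow> norm (f i) = 1" and \<alpha>: "\<And>i. i < k \<Longrightarrow> \<alpha> i > 0"
    and l: "\<And>i. i < k \<Longrightarrow> 0 \<le> l i" "(\<Sum>i<k. l i) = 1"
    and \<eta>: "0 < \<eta>" "\<eta> < 1/3"
  obtains y z where "\<And>i. i < k \<Longrightarrow> y i \<in> slice (f i) (\<alpha> i)" "\<And>i. i < k \<Longrightarrow> z i \<in> slice (f i) (\<alpha> i)"
    "2 * (1 - 3 * \<eta>) ^ CARD('n) \<le> dist (\<Sum>i<k. l i *\<^sub>R y i) (\<Sum>i<k. l i *\<^sub>R z i)"
proof -
  have "\<exists>x \<sigma>. norm x < 1 \<and> (\<sigma> = 1 \<or> \<sigma> = -1) \<and> 1 - \<alpha> i < \<sigma> * f i (of_sym_tensor (sym_power x))"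
    if "i < k" for i
    by (rule unit_functional_near_power[OF f[OF that] \<alpha>[OF that]]) blast
  then obtain x \<sigma> where x: "\<And>i. i < k \<Longrightarrow> norm (x i) < 1" and \<sigma>: "\<And>i. i < k \<Longrightarrow> \<sigma> i = 1 \<or> \<sigma> i = -1"
    and near: "\<And>i. i < k \<Longrightarrow> 1 - \<alpha> i < \<sigma> i * f i (of_sym_tensor (sym_power (x i)))"
    by metis
  define G where "G i z = \<sigma> i * f i (of_sym_tensor z)" for i z
  have G: "linear (G i)" for i
    by (rule linearI) (simp_all add: G_def linear_add[OF linear_of_sym_tensor]
        linear_scale[OF linear_of_sym_tensor] blinfun.add_right blinfun.scaleR_right algebra_simps)
  have G_le: "\<bar>G i z\<bar> \<le> sym_norm z" if "i < k" for i z
    using norm_blinfun[of "f i" "of_sym_tensor z"] f[OF that] \<sigma>[OF that]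
    by (auto simp: G_def norm_of_sym_tensor)
  have x': "norm (x i) < 1" if "i \<in> {..<k}" for i
    using that x by simp
  have \<sigma>': "\<sigma> i = 1 \<or> \<sigma> i = -1" if "i \<in> {..<k}" for i
    using that \<sigma> by simp
  have G_le': "\<bar>G i z\<bar> \<le> sym_norm z" if "i \<in> {..<k}" for i z
    using that G_le by simp
  have near': "1 - \<alpha> i < G i (sym_power (x i))" if "i \<in> {..<k}" for i
    using that near by (simp add: G_def)
  obtain u v :: "nat \<Rightarrow> 'a" and F :: "('a, 'n) sym_tensor \<Rightarrow> real" where
    u: "\<And>i. i < k \<Longrightarrow> norm (u i) < 1 \<and> 1 - \<alpha> i < G i (sym_power (u i))" and
    v: "\<And>i. i < k \<Longrightarrow> norm (v i) < 1 \<and> 1 - \<alpha> i < G i (sym_power (v i))" and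
    F: "linear F" "\<And>z. \<bar>F z\<bar> \<le> sym_norm z" and
    Fu: "\<And>i. i < k \<Longrightarrow> (1 - 3 * \<eta>) ^ CARD('n) \<le> \<sigma> i * F (sym_power (u i))" and
    Fv: "\<And>i. i < k \<Longrightarrow> \<sigma> i * F (sym_power (v i)) \<le> - ((1 - 3 * \<eta>) ^ CARD('n))"
    by (rule separated_powers[where x = x and G = G and \<beta> = "\<lambda>i. 1 - \<alpha> i" and \<sigma> = \<sigma>,
        OF asq finite_lessThan[of k] x' G G_le' near' \<sigma>' \<eta>]) (assumption | rule that | simp)+
  define T where "T w = (\<Sum>i<k. l i *\<^sub>R \<sigma> i *\<^sub>R (sym_power (w i) :: ('a, 'n) sym_tensor))" for w
  define Y where "Y w i = \<sigma> i *\<^sub>R of_sym_tensor (sym_power (w i) :: ('a, 'n) sym_tensor)" for w i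
  have slice: "Y w i \<in> slice (f i) (\<alpha> i)"
    if "i < k" "norm (w i) < 1" "1 - \<alpha> i < G i (sym_power (w i))" for w i
    using that(3) \<sigma>[OF that(1)] sym_norm_sym_power_le_one[OF that(2), where 'n = 'n]
    by (auto simp: slice_def Y_def G_def norm_of_sym_tensor blinfun.scaleR_right blinfun.minus_right)
  have T: "of_sym_tensor (T w) = (\<Sum>i<k. l i *\<^sub>R Y w i)" for w
    by (simp add: T_def Y_def linear_sum[OF linear_of_sym_tensor] linear_scale[OF linear_of_sym_tensor])
  have FT: "F (T w) = (\<Sum>i<k. l i * (\<sigma> i * F (sym_power (w i))))" for w
    by (simp add: T_def linear_sum[OF F(1)] linear_scale[OF F(1)] mult.assoc)
  let ?c = "(1 - 3 * \<eta>) ^ CARD('n)"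
  have "?c = (\<Sum>i<k. l i * ?c)" using l(2) by (simp add: sum_distrib_right[symmetric])
  also have "\<dots> \<le> F (T u)" unfolding FT using l(1) Fu by (intro sum_mono mult_left_mono) auto
  finally have "?c \<le> F (T u)" .
  have "F (T v) \<le> (\<Sum>i<k. l i * - ?c)" unfolding FT using l(1) Fv by (intro sum_mono mult_left_mono) auto
  also have "\<dots> = - ?c" using l(2) by (simp add: sum_distrib_right[symmetric] sum_negf)
  finally have "2 * ?c \<le> F (T u - T v)"
    using \<open>?c \<le> F (T u)\<close> by (simp add: linear_diff[OF F(1)])
  also have "\<dots> \<le> sym_norm (T u - T v)" using F(2)[of "T u - T v"] by simp
  also have "\<dots> = dist (\<Sum>i<k. l i *\<^sub>R Y u i) (\<Sum>i<k. l i *\<^sub>R Y v i)"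
    by (simp add: dist_norm norm_of_sym_tensor T[symmetric] linear_diff[OF linear_of_sym_tensor, symmetric])
  finally show ?thesis
    using u v by (intro that[of "Y u" "Y v"] slice) auto
qed

theorem theorem3p3:
  assumes "(UNIV :: 'a::banach set) \<noteq> {0}"
    and "almost_square TYPE('a)"
  shows "strong_diameter_two_property TYPE(('a, 'n::finite) sym_proj_tensor)"
  unfolding strong_diameter_two_property_def
proof
  fix C :: "('a, 'n) sym_proj_tensor set"
  assume "C \<in> convex_combinations_of_slices"
  then obtain k :: nat and l :: "nat \<Rightarrow> real" and S :: "nat \<Rightarrow> ('a, 'n) sym_proj_tensor set" where
    C: "C = {\<Sum>i<k. l i *\<^sub>R y i | y. \<forall>i<k. y i \<in> S i}" and
    S: "\<And>i. i < k \<Longrightarrow> S i \<in> unit_ball_slices" and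
    l: "\<And>i. i < k \<Longrightarrow> 0 \<le> l i" "(\<Sum>i<k. l i) = 1"
    unfolding convex_combinations_of_slices_def by auto
  from S obtain f \<alpha> where f: "\<And>i. i < k \<Longrightarrow> norm (f i) = 1" and \<alpha>: "\<And>i. i < k \<Longrightarrow> \<alpha> i > 0"
    and Sf: "\<And>i. i < k \<Longrightarrow> S i = slice (f i) (\<alpha> i)"
    unfolding unit_ball_slices_def by simp metis
  have ball: "norm c \<le> 1" if "c \<in> C" for c
  proof -
    from that obtain y where y: "\<And>i. i < k \<Longrightarrow> y i \<in> S i" and c: "c = (\<Sum>i<k. l i *\<^sub>R y i)"
      unfolding C by blast
    have "norm c \<le> (\<Sum>i<k. l i * 1)"
      unfolding c
    proof (rule sum_norm_le)
      fix i assume "i \<in> {..<k}"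
      then have "norm (y i) \<le> 1" "0 \<le> l i" using y Sf l(1) by (auto simp: slice_def)
      then show "norm (l i *\<^sub>R y i) \<le> l i * 1" by (simp add: mult_left_le)
    qed
    then show ?thesis using l(2) by simp
  qed
  have "diameter C \<le> 2"
  proof (rule diameter_le)
    fix c d assume "c \<in> C" "d \<in> C"
    then show "norm (c - d) \<le> 2" using ball[of c] ball[of d] norm_triangle_ineq4[of c d] by linarith
  qed simp
  have bounded: "bounded C" using ball by (auto simp: bounded_iff)
  have lower: "2 * (1 - 3 * \<eta>) ^ CARD('n) \<le> diameter C" if \<eta>: "0 < \<eta>" "\<eta> < 1/3" for \<eta> :: real
  proof -
    obtain y z where yz: "\<And>i. i < k \<Longrightarrow> y i \<in> slice (f i) (\<alpha> i)" "\<And>i. i < k \<Longrightarrow> z i \<in> slice (f i) (\<alpha> i)"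
      and dist: "2 * (1 - 3 * \<eta>) ^ CARD('n) \<le> dist (\<Sum>i<k. l i *\<^sub>R y i) (\<Sum>i<k. l i *\<^sub>R z i)"
      by (rule almost_square_imp_distance[where f = f and \<alpha> = \<alpha> and l = l, OF assms(2) f \<alpha> l \<eta>]) (assumption | rule that)+
    have "(\<Sum>i<k. l i *\<^sub>R y i) \<in> C" "(\<Sum>i<k. l i *\<^sub>R z i) \<in> C"
      unfolding C using yz Sf by blast+
    from diameter_bounded_bound[OF bounded this] dist show ?thesis by simp
  qed
  have "((\<lambda>\<eta>. 2 * (1 - 3 * \<eta>) ^ CARD('n)) \<longlongrightarrow> 2 * (1 - 3 * 0) ^ CARD('n)) (at_right (0::real))"
    by (intro tendsto_intros)
  moreover have "\<forall>\<^sub>F \<eta> in at_right (0::real). 2 * (1 - 3 * \<eta>) ^ CARD('n) \<le> diameter C"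
    using eventually_at_right_real[of 0 "1/3"] by (rule eventually_mono) (auto intro: lower)
  ultimately have "2 * (1 - 3 * 0) ^ CARD('n) \<le> diameter C"
    by (rule tendsto_upperbound) simp
  with \<open>diameter C \<le> 2\<close> show "diameter C = 2" by simp
qed

end
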